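(* Let $d\ge 2$ and let $P$ be a $d$-dimensional polytope in a Euclidean space. Then \[ \frac{\Phi(P)}{\operatorname{diam}(P)} \le \sqrt{\frac{d+1}{2\left\lfloor (d+1)^2/4\right\rfloor}}, \] with equality if and only if $P$ is a regular simplex.
   Context: The ambient space of $P$ is a finite-dimensional real vector space endowed with the Euclidean norm $\|\cdot\|$ (its dimension may exceed $d=\dim P$). A polytope is the convex hull of finitely many points; $\operatorname{vert}(P)$ denotes the set of vertices of $P$. Let $\mathcal F$ be the set of proper faces of $P$, that is, all faces of $P$ other than $\emptyset$ and $P$. For nonempty compact sets $A,B$, $\operatorname{dist}(A,B)=\min\{\|x-y\|:x\in A,\ y\in B\}$. The facial distance of $P$ is \[ \Phi(P)=\min_{F\in\mathcal F}\operatorname{dist}\bigl(F,\operatorname{conv}(\operatorname{vert}(P)\setminus F)\bigr), \] and the diameter is $\operatorname{diam}(P)=\max_{x,y\in P}\|x-y\|$. A regular simplex of dimension $d$ is the convex hull of $d+1$ affinely independent points that are pairwise equidistant. *)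

theory Defs
  imports "HOL-Analysis.Analysis"
begin

definition vertices :: "'a::euclidean_space set \<Rightarrow> 'a set" where
  "vertices P = {v. v extreme_point_of P}"

definition proper_faces :: "'a::euclidean_space set \<Rightarrow> 'a set set" where
  "proper_faces P = {F. F face_of P \<and> F \<noteq> {} \<and> F \<noteq> P}"

text \<open>\<open>Min\<close> is meaningless on infinite or empty sets, and \<open>setdist\<close> is 0 when an argument
  is empty.  The lemmas below exclude these cases for polytopes of positive dimension.\<close>

definition facial_distance :: "'a::euclidean_space set \<Rightarrow> real" where
  "facial_distance P =
     Min ((\<lambda>F. setdist F (convex hull (vertices P - F))) ` proper_faces P)"

lemma finite_proper_faces:
  assumes "polytope P"
  shows "finite (proper_faces P)"
  by (rule finite_subset[OF _ finite_polytope_faces[OF assms]]) (auto simp: proper_faces_def)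

lemma vertices_not_in_proper_face:
  assumes "polytope P" "F \<in> proper_faces P"
  shows "vertices P - F \<noteq> {}"
proof
  assume "vertices P - F = {}"
  then have "vertices P \<subseteq> F" by blast
  moreover have "convex F" "F \<subseteq> P"
    using assms(2) by (auto simp: proper_faces_def face_of_def)
  ultimately have "convex hull (vertices P) \<subseteq> F"
    by (simp add: hull_minimal)
  moreover have "P = convex hull (vertices P)"
    unfolding vertices_def
    by (rule Krein_Milman_Minkowski)
       (use assms(1) in \<open>auto simp: polytope_imp_compact polytope_imp_convex\<close>)
  ultimately show False
    using assms(2) \<open>F \<subseteq> P\<close> by (auto simp: proper_faces_def)
qed

lemma proper_faces_nonempty:
  assumes "polytope P" "aff_dim P \<ge> 1"
  shows "proper_faces P \<noteq> {}"
proof -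
  have "P \<noteq> {}" using assms(2) by auto
  then obtain v where v: "v extreme_point_of P"
    using extreme_point_exists_convex assms(1) polytope_imp_compact polytope_imp_convex by blast
  then have "{v} face_of P" by (simp add: face_of_singleton)
  moreover have "{v} \<noteq> P" using assms(2) by auto
  ultimately show ?thesis by (auto simp: proper_faces_def)
qed

definition regular_simplex :: "nat \<Rightarrow> 'a::euclidean_space set \<Rightarrow> bool" where
  "regular_simplex d S \<longleftrightarrow>
     (\<exists>C r. \<not> affine_dependent C \<and> card C = d + 1 \<and>
        (\<forall>x\<in>C. \<forall>y\<in>C. x \<noteq> y \<longrightarrow> dist x y = r) \<and>
        S = convex hull C)"

end

theory Submission
  imports Defs
begin

text \<open>
  Write \<open>n = d + 1\<close> and \<open>D\<close> for the diameter. If an affine function \<open>h\<close> is nonnegative on \<open>P\<close> and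
  the vertices with \<open>h \<le> 1\<close> affinely span \<open>P\<close>, then the facial distance is at most
  \<open>1 / \<bar>\<nabla>h\<bar>\<close>; so one needs such an \<open>h\<close> with a steep gradient. It is built up along a flag of
  faces. An admissible function on a facet extends to \<open>P\<close> in two ways, with minimum \<open>0\<close> or with
  minimum \<open>1\<close> on the remaining vertices. Passing from a face of codimension two through either of
  the two facets containing it (first extension with minimum \<open>0\<close>, second with minimum \<open>1\<close>) increases
  \<open>\<bar>\<nabla>h\<bar>\<^sup>2\<close> by at least \<open>1 / D\<^sup>2\<close> for one of the two facets. Starting with an edge of length \<open>l\<close>
  this gives \<open>\<bar>\<nabla>h\<bar>\<^sup>2 \<ge> 1 / l\<^sup>2 + (n / 2 - 1) / D\<^sup>2\<close> for even \<open>n\<close>, which is the bound.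

  For odd \<open>n\<close> one extends once more, from a facet \<open>F\<close> of circumradius \<open>\<rho>\<close>. The two extensions differ by
  a gradient of length at least \<open>1 / sqrt (D\<^sup>2 - \<rho>\<^sup>2)\<close>, so one of them gains
  \<open>1 / (4 (D\<^sup>2 - \<rho>\<^sup>2))\<close>. Taking \<open>l\<close> to be the length of the shortest edge of \<open>F\<close>, a small \<open>\<rho>\<close> forces a
  small \<open>l\<close>, and the two effects balance exactly when \<open>l = D\<close>.

  In both cases the estimate is strict as soon as some edge is shorter than \<open>D\<close>. A polytope that is
  not a simplex has an edge of length at most \<open>sqrt 2 \<rho> < D\<close>, so equality leaves only the regular
  simplex.
\<close>

section \<open>Faces and vertices of polytopes\<close>

lemma finite_vertices:
  fixes P :: "'a::euclidean_space set"
  assumes "polytope P" shows "finite (vertices P)"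
  unfolding vertices_def
  using finite_polyhedron_extreme_points[OF polytope_imp_polyhedron[OF assms]] .

lemma convex_hull_vertices:
  fixes P :: "'a::euclidean_space set"
  assumes "polytope P" shows "convex hull (vertices P) = P"
  unfolding vertices_def
  using Krein_Milman_Minkowski[of P] assms polytope_imp_compact polytope_imp_convex by auto

lemma vertices_subset: "vertices P \<subseteq> P"
  by (auto simp: vertices_def extreme_point_of_def)

lemma vertices_face:
  assumes "F face_of P" shows "vertices F = vertices P \<inter> F"
  using extreme_point_of_face[OF assms] by (auto simp: vertices_def)

text \<open>A minimal face containing \<open>q\<close> works: on its relative boundary
  \<open>q\<close> would lie in a facet, a smaller face.\<close>

lemma face_rel_interior_exists:
  fixes P :: "'a::euclidean_space set"
  assumes "polytope P" "q \<in> P"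
  obtains F where "F face_of P" "q \<in> rel_interior F"
proof -
  let ?A = "{F. F face_of P \<and> q \<in> F}"
  have fin: "finite ?A"
    by (rule finite_subset[OF _ finite_polytope_faces[OF assms(1)]]) auto
  have ne: "?A \<noteq> {}"
    using face_of_refl[OF polytope_imp_convex[OF assms(1)]] assms(2) by blast
  obtain F where F: "F \<in> ?A" and min: "\<And>G. G \<in> ?A \<Longrightarrow> G \<subseteq> F \<Longrightarrow> G = F"
    using finite_has_minimal[OF fin ne] by (metis)
  have polF: "polyhedron F"
    using F assms(1) face_of_polytope_polytope polytope_imp_polyhedron by blast
  have "q \<in> rel_interior F"
  proof (rule ccontr)
    assume "q \<notin> rel_interior F"
    then obtain G where G: "G facet_of F" "q \<in> G"
      using rel_boundary_of_polyhedron[OF polF] F by blast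
    have "G face_of P" using G F facet_of_imp_face_of face_of_trans by blast
    then have "G = F" using min[of G] G facet_of_imp_subset by blast
    then show False using G by auto
  qed
  then show ?thesis using that F by blast
qed

text \<open>Remove from \<open>x\<close> and \<open>y\<close> as large a common part \<open>(1 - \<rho>) r\<close> as possible. If the face carrying
  \<open>q\<close> still met the vertices used for \<open>p\<close>, more could be removed.\<close>

lemma separated_decomposition:
  fixes P :: "'a::euclidean_space set"
  assumes P: "polytope P" and T: "T \<subseteq> vertices P"
    and x: "x \<in> convex hull T" and y: "y \<in> P" and xy: "x \<noteq> y"
  obtains \<rho> p q F where "0 < \<rho>" "\<rho> \<le> 1" "x - y = \<rho> *\<^sub>R (p - q)"
    "F \<in> proper_faces P" "q \<in> F" "p \<in> convex hull (T - F)"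
proof -
  define K where "K = convex hull T"
  have finT: "finite T" using finite_subset[OF T finite_vertices[OF P]] .
  have compK: "compact K" and convK: "convex K"
    unfolding K_def using finT finite_imp_compact_convex_hull by auto
  have compP: "compact P" and convP: "convex P"
    using P polytope_imp_compact polytope_imp_convex by auto
  have TP: "T \<subseteq> P" using T vertices_subset by blast
  have KP: "K \<subseteq> P" unfolding K_def using TP convP by (simp add: hull_minimal)
  \<comment> \<open>All ways of splitting off a common part \<open>r\<close> from \<open>x\<close>
    and \<open>y\<close>; \<open>\<rho>\<close> is minimised over this compact set, and
    \<open>(1, x, y, x)\<close> is the trivial splitting.\<close>
  define S where "S = ({0..1::real} \<times> K \<times> P \<times> K) \<inter>
     {t. x = fst t *\<^sub>R fst (snd t) + (1 - fst t) *\<^sub>R snd (snd (snd t))} \<inter>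
     {t. y = fst t *\<^sub>R fst (snd (snd t)) + (1 - fst t) *\<^sub>R snd (snd (snd t))}"
  have "closed {t :: real \<times> 'a \<times> 'a \<times> 'a.
      x = fst t *\<^sub>R fst (snd t) + (1 - fst t) *\<^sub>R snd (snd (snd t))}"
    by (rule closed_Collect_eq) (intro continuous_intros)+
  moreover have "closed {t :: real \<times> 'a \<times> 'a \<times> 'a.
      y = fst t *\<^sub>R fst (snd (snd t)) + (1 - fst t) *\<^sub>R snd (snd (snd t))}"
    by (rule closed_Collect_eq) (intro continuous_intros)+
  moreover have "compact ({0..1::real} \<times> K \<times> P \<times> K)"
    by (simp add: compact_Times compK compP)
  ultimately have "compact S" unfolding S_def by (simp add: compact_Int_closed)
  moreover have "(1, x, y, x) \<in> S" using x y by (auto simp: S_def K_def)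
  moreover have "continuous_on S (fst :: real \<times> 'a \<times> 'a \<times> 'a \<Rightarrow> real)"
    by (intro continuous_intros)
  ultimately obtain t where t: "t \<in> S" and tmin: "\<And>s. s \<in> S \<Longrightarrow> fst t \<le> fst s"
    using continuous_attains_inf[of S fst] by blast
  obtain \<rho> p q r where t_eq: "t = (\<rho>, p, q, r)" by (metis surj_pair)
  have \<rho>: "0 \<le> \<rho>" "\<rho> \<le> 1" and p: "p \<in> K" and q: "q \<in> P" and r: "r \<in> K"
    and xe: "x = \<rho> *\<^sub>R p + (1 - \<rho>) *\<^sub>R r" and ye: "y = \<rho> *\<^sub>R q + (1 - \<rho>) *\<^sub>R r"
    using t by (auto simp: S_def t_eq)
  have eq: "x - y = \<rho> *\<^sub>R (p - q)" by (simp add: xe ye scaleR_diff_right)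
  have \<rho>0: "0 < \<rho>" using eq xy \<rho>(1) by (cases "\<rho> = 0") auto
  obtain F where F: "F face_of P" and qF: "q \<in> rel_interior F"
    using face_rel_interior_exists[OF P q] .
  have convF: "convex F" using F face_of_imp_convex by blast
  \<comment> \<open>If \<open>p\<close> contains a share \<open>s\<close> of a point
    \<open>b\<close> of \<open>F\<close>, push \<open>p\<close> and \<open>q\<close> away from
    \<open>b\<close> by a factor \<open>e > 1\<close>. Relative interiority keeps \<open>q'\<close>
    in \<open>F\<close>, the share keeps \<open>p'\<close> in \<open>K\<close>, and \<open>b\<close>
    moves into the common part, which lowers \<open>\<rho>\<close> to
    \<open>\<rho> / e\<close>.\<close>
  have no: False if b: "b \<in> F" "b \<in> K" and a: "a \<in> K" and s: "0 < s" "s \<le> 1"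
    and pe: "p = (1 - s) *\<^sub>R a + s *\<^sub>R b" for a b s
  proof -
    obtain m where m: "m > 1" "\<And>e. e > 1 \<Longrightarrow> e \<le> m \<Longrightarrow> (1 - e) *\<^sub>R b + e *\<^sub>R q \<in> F"
      using convex_rel_interior_if[OF convF qF] b(1) hull_inc[of b F affine] by blast
    \<comment> \<open>The cap \<open>1 + s\<close> gives \<open>e * (1 - s) \<le> 1\<close>, so
      \<open>b\<close> keeps a nonnegative weight in \<open>p'\<close>.\<close>
    define e where "e = min m (1 + s)"
    have e: "e > 1" "e \<le> m" "e \<le> 1 + s" using m s by (auto simp: e_def)
    have es: "e * (1 - s) \<le> 1"
    proof -
      have "e * (1 - s) \<le> (1 + s) * (1 - s)" using e s by (intro mult_right_mono) auto
      also have "\<dots> \<le> 1" by (simp add: algebra_simps)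
      finally show ?thesis .
    qed
    define q' where "q' = (1 - e) *\<^sub>R b + e *\<^sub>R q"
    define p' where "p' = (1 - e) *\<^sub>R b + e *\<^sub>R p"
    have q': "q' \<in> P" using m(2)[of e] e F face_of_imp_subset by (auto simp: q'_def)
    have "p' = (1 - e * (1 - s)) *\<^sub>R b + (e * (1 - s)) *\<^sub>R a"
      by (simp add: p'_def pe algebra_simps)
    then have p': "p' \<in> K"
      using convexD[OF convK b(2) a, of "1 - e * (1 - s)" "e * (1 - s)"] es e s by simp
    define \<rho>' where "\<rho>' = \<rho> / e"
    have \<rho>': "0 \<le> \<rho>'" "\<rho>' < \<rho>" "\<rho>' < 1" using \<rho> \<rho>0 e by (auto simp: \<rho>'_def field_simps)
    define r' where "r' = ((\<rho> - \<rho>') / (1 - \<rho>')) *\<^sub>R b + ((1 - \<rho>) / (1 - \<rho>')) *\<^sub>R r"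
    have r': "r' \<in> K" unfolding r'_def
      using convexD[OF convK b(2) r, of "(\<rho> - \<rho>') / (1 - \<rho>')" "(1 - \<rho>) / (1 - \<rho>')"] \<rho> \<rho>'
      by (simp add: add_divide_distrib[symmetric])
    have r'e: "(1 - \<rho>') *\<^sub>R r' = (\<rho> - \<rho>') *\<^sub>R b + (1 - \<rho>) *\<^sub>R r"
      using \<rho>' by (simp add: r'_def scaleR_add_right)
    have ee: "\<rho>' * e = \<rho>" using e by (simp add: \<rho>'_def)
    have sh: "\<rho>' *\<^sub>R ((1 - e) *\<^sub>R b + e *\<^sub>R v) = (\<rho>' - \<rho>) *\<^sub>R b + \<rho> *\<^sub>R v" for v
      by (simp only: scaleR_add_right scaleR_scaleR right_diff_distrib ee mult_1_right)
    have sw: "(\<rho>' - \<rho>) *\<^sub>R b = - ((\<rho> - \<rho>') *\<^sub>R b)"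
      by (metis minus_diff_eq scaleR_minus_left)
    have x': "x = \<rho>' *\<^sub>R p' + (1 - \<rho>') *\<^sub>R r'"
      unfolding p'_def sh r'e sw by (subst xe) simp
    have y': "y = \<rho>' *\<^sub>R q' + (1 - \<rho>') *\<^sub>R r'"
      unfolding q'_def sh r'e sw by (subst ye) simp
    have "(\<rho>', p', q', r') \<in> {0..1::real} \<times> K \<times> P \<times> K" using p' q' r' \<rho>' by simp
    then have "(\<rho>', p', q', r') \<in> S"
      unfolding S_def Int_iff mem_Collect_eq fst_conv snd_conv using x' y' by blast
    from tmin[OF this] \<rho>' show False by (simp add: t_eq)
  qed
  \<comment> \<open>Split \<open>p\<close> into a part over \<open>T - F\<close> and a part over
    \<open>T \<inter> F\<close>; the latter is a point of both \<open>F\<close> and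
    \<open>K\<close>, so by \<open>no\<close> it has weight zero.\<close>
  have pF: "p \<in> convex hull (T - F)"
  proof (cases "T \<inter> F = {}")
    case True
    then have "T - F = T" by blast
    then show ?thesis using p by (simp add: K_def)
  next
    case False
    have sub1: "convex hull (T \<inter> F) \<subseteq> F" using convF by (simp add: hull_minimal)
    have sub2: "convex hull (T \<inter> F) \<subseteq> K" unfolding K_def by (simp add: hull_mono)
    have sub3: "convex hull (T - F) \<subseteq> K" unfolding K_def by (simp add: hull_mono)
    show ?thesis
    proof (cases "T - F = {}")
      case True
      then have "T \<inter> F = T" by blast
      then have "p \<in> F" using sub1 p by (auto simp: K_def)
      then show ?thesis using no[of p p 1] p by simp
    next
      case ne: False
      have "K = convex hull (convex hull (T - F) \<union> convex hull (T \<inter> F))"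
        unfolding K_def hull_Un_left[symmetric] hull_Un_right[symmetric] by (rule arg_cong) blast
      also have "\<dots> = {u *\<^sub>R a + v *\<^sub>R b |u v a b.
          0 \<le> u \<and> 0 \<le> v \<and> u + v = 1 \<and> a \<in> convex hull (T - F) \<and> b \<in> convex hull (T \<inter> F)}"
        using ne False by (intro convex_hull_union_two) auto
      finally obtain a b u v where ab: "a \<in> convex hull (T - F)" "b \<in> convex hull (T \<inter> F)"
        and uv: "0 \<le> u" "0 \<le> v" "u + v = 1" "p = u *\<^sub>R a + v *\<^sub>R b"
        using p by blast
      have u: "u = 1 - v" using uv by simp
      have "\<not> 0 < v" using no[of b a v] ab sub1 sub2 sub3 uv(1,3,4) unfolding u by fastforce
      then have "v = 0" using uv by simp
      then show ?thesis using ab uv by simp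
    qed
  qed
  have "F \<noteq> P"
  proof
    assume "F = P"
    then have "T - F = {}" using TP by blast
    then show False using pF by (metis convex_hull_empty empty_iff)
  qed
  then have "F \<in> proper_faces P" using F qF rel_interior_subset[of F] by (auto simp: proper_faces_def)
  then show ?thesis using that[OF \<rho>0 \<rho>(2) eq] qF rel_interior_subset[of F] pF by blast
qed

section \<open>Admissible affine functions\<close>

text \<open>The linear space parallel to the affine hull; it is trivial for the empty set.\<close>

definition dirspace :: "'a::euclidean_space set \<Rightarrow> 'a set" where
  "dirspace P = span {x - y | x y. x \<in> P \<and> y \<in> P}"

text \<open>The affine function is \<open>h x = z \<bullet> x + b\<close>; its gradient \<open>z\<close> is taken parallel to the affine hull.\<close>

definition slab :: "'a::euclidean_space set \<Rightarrow> 'a \<Rightarrow> real \<Rightarrow> bool" where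
  "slab P z b \<longleftrightarrow> z \<in> dirspace P \<and> (\<forall>v\<in>vertices P. 0 \<le> z \<bullet> v + b) \<and>
     affine hull {v \<in> vertices P. z \<bullet> v + b \<le> 1} = affine hull P"

lemma dirspace_mono: "F \<subseteq> P \<Longrightarrow> dirspace F \<subseteq> dirspace P"
  unfolding dirspace_def by (intro span_mono) blast

lemma diff_in_dirspace: "x \<in> P \<Longrightarrow> y \<in> P \<Longrightarrow> x - y \<in> dirspace P"
  unfolding dirspace_def by (intro span_base) blast

lemma subspace_dirspace: "subspace (dirspace P)"
  unfolding dirspace_def by simp

lemma affine_hull_add_dirspace:
  assumes "z \<in> dirspace P" "x \<in> affine hull P"
  shows "x + z \<in> affine hull P"
proof -
  let ?S = "{z. \<forall>x \<in> affine hull P. x + z \<in> affine hull P}"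
  have "subspace ?S"
  proof (rule subspaceI)
    fix a b assume "a \<in> ?S" "b \<in> ?S"
    then show "a + b \<in> ?S" by (auto simp: add.assoc[symmetric])
  next
    fix c :: real and a assume a: "a \<in> ?S"
    show "c *\<^sub>R a \<in> ?S"
    proof safe
      fix x assume x: "x \<in> affine hull P"
      have "x + c *\<^sub>R ((x + a) - x) \<in> affine hull P"
        using mem_affine_3_minus[OF affine_affine_hull x _ x] a x by blast
      then show "x + c *\<^sub>R a \<in> affine hull P" by simp
    qed
  qed simp
  moreover have "{x - y | x y. x \<in> P \<and> y \<in> P} \<subseteq> ?S"
  proof clarsimp
    fix u v x assume "u \<in> P" "v \<in> P" "x \<in> affine hull P"
    then have "x + 1 *\<^sub>R (u - v) \<in> affine hull P"
      by (intro mem_affine_3_minus affine_affine_hull) (auto intro: hull_inc)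
    then show "x + (u - v) \<in> affine hull P" by simp
  qed
  ultimately have "dirspace P \<subseteq> ?S" unfolding dirspace_def by (rule span_minimal[rotated])
  with assms show ?thesis by blast
qed

text \<open>Let \<open>h x = z \<bullet> x + b\<close>. In the relative interior of the hull of the
  vertices with \<open>h \<le> 1\<close> there is room for a step along \<open>-z\<close>. Splitting
  this step gives \<open>p - q\<close> parallel to \<open>z\<close> with \<open>h p \<le> 1\<close>
  and \<open>h q \<ge> 0\<close>. Hence \<open>norm z * norm (p - q) \<le> 1\<close>, while
  \<open>norm (p - q)\<close> is at least the facial distance.\<close>

lemma slab_facial_distance:
  fixes P :: "'a::euclidean_space set"
  assumes P: "polytope P" and slab: "slab P z b"
  shows "facial_distance P * norm z \<le> 1"
proof (cases "z = 0")
  case True then show ?thesis by simp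
next
  case z: False
  define T where "T = {v \<in> vertices P. z \<bullet> v + b \<le> 1}"
  have TV: "T \<subseteq> vertices P" by (auto simp: T_def)
  have aff: "affine hull T = affine hull P" and zd: "z \<in> dirspace P"
    and nonneg: "\<And>v. v \<in> vertices P \<Longrightarrow> 0 \<le> z \<bullet> v + b"
    using slab by (auto simp: slab_def T_def)
  have "P \<noteq> {}" using z zd by (auto simp: dirspace_def)
  then have "T \<noteq> {}" using aff by auto
  then obtain x where x: "x \<in> rel_interior (convex hull T)"
    using rel_interior_eq_empty[of "convex hull T"] by auto
  obtain e where e: "e > 0" "cball x e \<inter> affine hull (convex hull T) \<subseteq> convex hull T"
    using x mem_rel_interior_cball by blast
  define t where "t = e / norm z"
  have t: "t > 0" using e z by (simp add: t_def)
  define y where "y = x - t *\<^sub>R z"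
  have xT: "x \<in> convex hull T" using x rel_interior_subset by blast
  have "- t *\<^sub>R z \<in> dirspace P" using subspace_dirspace zd subspace_scale by blast
  moreover have "x \<in> affine hull P"
    using xT aff convex_hull_subset_affine_hull by blast
  ultimately have "y \<in> affine hull P"
    using affine_hull_add_dirspace[of "- t *\<^sub>R z" P x] by (simp add: y_def)
  moreover have "y \<in> cball x e" using t e z by (simp add: y_def t_def dist_norm)
  ultimately have yT: "y \<in> convex hull T" using e(2) aff by auto
  have "convex hull T \<subseteq> convex hull (vertices P)" using TV by (rule hull_mono)
  then have yP: "y \<in> P" using yT convex_hull_vertices[OF P] by blast
  have "x \<noteq> y" using t z by (simp add: y_def)
  then obtain \<rho> p q F where \<rho>: "0 < \<rho>" "\<rho> \<le> 1" and eq: "x - y = \<rho> *\<^sub>R (p - q)"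
    and F: "F \<in> proper_faces P" and q: "q \<in> F" and p: "p \<in> convex hull (T - F)"
    using separated_decomposition[OF P TV xT yP] by blast
  have hp: "z \<bullet> p + b \<le> 1"
  proof -
    have "convex hull (T - F) \<subseteq> {x. z \<bullet> x \<le> 1 - b}"
      by (intro hull_minimal convex_halfspace_le) (auto simp: T_def)
    then show ?thesis using p by auto
  qed
  have hq: "0 \<le> z \<bullet> q + b"
  proof -
    have "convex hull (vertices P) \<subseteq> {x. z \<bullet> x \<ge> - b}"
      using nonneg by (intro hull_minimal convex_halfspace_ge) (smt (verit) mem_Collect_eq subsetI)
    moreover have "q \<in> P" using F q by (auto simp: proper_faces_def face_of_def)
    ultimately show ?thesis using convex_hull_vertices[OF P] by force
  qed
  have "facial_distance P \<le> setdist F (convex hull (vertices P - F))"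
    unfolding facial_distance_def using finite_proper_faces[OF P] F by (intro Min_le) auto
  also have "\<dots> \<le> dist q p"
  proof (rule setdist_le_dist[OF q])
    have "convex hull (T - F) \<subseteq> convex hull (vertices P - F)" using TV by (intro hull_mono) blast
    then show "p \<in> convex hull (vertices P - F)" using p by blast
  qed
  finally have fd: "facial_distance P \<le> norm (p - q)" by (simp add: dist_norm norm_minus_commute)
  have tz: "t *\<^sub>R z = \<rho> *\<^sub>R (p - q)" using eq by (simp add: y_def)
  have "t * norm z = \<rho> * norm (p - q)" using arg_cong[OF tz, of norm] t \<rho> by simp
  then have 1: "\<rho> * facial_distance P \<le> t * norm z" using fd \<rho> by simp
  have "t * (norm z)\<^sup>2 = \<rho> * (z \<bullet> p - z \<bullet> q)"
    using arg_cong[OF tz, of "\<lambda>v. z \<bullet> v"] by (simp add: power2_norm_eq_inner inner_diff_right)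
  also have "\<dots> \<le> \<rho> * 1" using hp hq \<rho> by (intro mult_left_mono) auto
  finally have 2: "t * (norm z)\<^sup>2 \<le> \<rho>" by simp
  have "\<rho> * facial_distance P * norm z \<le> t * norm z * norm z"
    using 1 by (intro mult_right_mono) auto
  also have "\<dots> \<le> \<rho>" using 2 by (simp add: power2_eq_square mult.assoc)
  finally have "\<rho> * (facial_distance P * norm z) \<le> \<rho> * 1" by (simp add: mult.assoc)
  then show ?thesis using \<rho>(1) by (simp only: mult_le_cancel_left_pos)
qed

section \<open>Extending an admissible function from a facet\<close>

lemma facet_normal:
  fixes P :: "'a::euclidean_space set"
  assumes P: "polytope P" and F: "F facet_of P"
  obtains e c where "e \<in> dirspace P" "\<And>y. y \<in> dirspace F \<Longrightarrow> e \<bullet> y = 0"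
    "\<And>x. x \<in> F \<Longrightarrow> e \<bullet> x = c" "\<And>x. x \<in> P - F \<Longrightarrow> c < e \<bullet> x"
proof -
  have "F face_of P" "F \<noteq> {}" using F by (auto simp: facet_of_def)
  then have "F exposed_face_of P"
    using exposed_face_of_polyhedron[OF polytope_imp_polyhedron[OF P]] by blast
  then obtain a b where ab: "P \<subseteq> {x. a \<bullet> x \<le> b}" "F = P \<inter> {x. a \<bullet> x = b}"
    by (auto simp: exposed_face_of_def)
  \<comment> \<open>Only the component \<open>y\<close> of the normal parallel to \<open>P\<close>
    is kept; the component \<open>z\<close> is constant on \<open>P\<close>. The sign in
    \<open>e = - y\<close> makes \<open>e\<close> grow away from \<open>F\<close>.\<close>
  obtain y z where y: "y \<in> dirspace P" and z: "\<And>w. w \<in> dirspace P \<Longrightarrow> orthogonal z w"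
    and a: "a = y + z"
    using orthogonal_subspace_decomp_exists[of "{x - y | x y. x \<in> P \<and> y \<in> P}" a]
    unfolding dirspace_def by blast
  obtain f where f: "f \<in> F" using \<open>F \<noteq> {}\<close> by blast
  have fP: "f \<in> P" using f ab by blast
  define e where "e = - y"
  define c where "c = e \<bullet> f"
  have ex: "e \<bullet> x = c + (b - a \<bullet> x)" if "x \<in> P" for x
  proof -
    have "z \<bullet> (x - f) = 0"
      using z[OF diff_in_dirspace[OF that fP]] by (simp add: orthogonal_def)
    moreover have "a \<bullet> f = b" using f ab by blast
    ultimately show ?thesis by (simp add: e_def c_def a algebra_simps)
  qed
  have eF: "e \<bullet> x = c" if "x \<in> F" for x using ex[of x] that ab by auto
  have "dirspace F \<subseteq> {w. e \<bullet> w = 0}"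
    unfolding dirspace_def
    by (rule span_minimal) (auto simp: eF inner_diff_right subspace_hyperplane)
  moreover have "c < e \<bullet> x" if "x \<in> P - F" for x using ex[of x] that ab by force
  moreover have "e \<in> dirspace P" unfolding e_def using y subspace_dirspace subspace_neg by blast
  ultimately show ?thesis using that[of e c] eF by blast
qed

text \<open>Adding a multiple \<open>g\<close> of the facet normal tilts the function off
  \<open>F\<close> without changing it on \<open>F\<close>. The largest slope demanded by an outside
  vertex puts that vertex at height \<open>\<theta>\<close> and the others at or above it. As
  \<open>\<theta> \<le> 1\<close>, this vertex joins the spanning vertices of \<open>F\<close>, and
  together they span \<open>P\<close>.\<close>

lemma slab_extend:
  fixes P :: "'a::euclidean_space set"
  assumes P: "polytope P" and F: "F facet_of P" and slab: "slab F p b"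
    and \<theta>: "0 \<le> \<theta>" "\<theta> \<le> 1"
  obtains z b' v where "slab P z b'" "\<And>y. y \<in> dirspace F \<Longrightarrow> (z - p) \<bullet> y = 0"
    "\<And>x. x \<in> F \<Longrightarrow> z \<bullet> x + b' = p \<bullet> x + b"
    "v \<in> vertices P - F" "z \<bullet> v + b' = \<theta>"
    "\<And>w. w \<in> vertices P - F \<Longrightarrow> \<theta> \<le> z \<bullet> w + b'"
proof -
  obtain e c where e: "e \<in> dirspace P" and e0: "\<And>y. y \<in> dirspace F \<Longrightarrow> e \<bullet> y = 0"
    and ec: "\<And>x. x \<in> F \<Longrightarrow> e \<bullet> x = c" and ec': "\<And>x. x \<in> P - F \<Longrightarrow> c < e \<bullet> x"
    using facet_normal[OF P F] by blast
  have FP: "F face_of P" using F facet_of_imp_face_of by blast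
  have "F \<in> proper_faces P" using F by (auto simp: proper_faces_def facet_of_def)
  then have ne: "vertices P - F \<noteq> {}" using vertices_not_in_proper_face[OF P] by blast
  define q where "q w = (\<theta> - (p \<bullet> w + b)) / (e \<bullet> w - c)" for w
  have fin: "finite (q ` (vertices P - F))" using finite_vertices[OF P] by auto
  define g where "g = Max (q ` (vertices P - F))"
  have "g \<in> q ` (vertices P - F)" unfolding g_def using fin ne by (intro Max_in) auto
  then obtain v where v: "v \<in> vertices P - F" "g = q v" by blast
  define z where "z = p + g *\<^sub>R e"
  define b' where "b' = b - g * c"
  have h: "z \<bullet> x + b' = p \<bullet> x + b + g * (e \<bullet> x - c)" for x
    by (simp add: z_def b'_def algebra_simps)
  have pos: "0 < e \<bullet> w - c" if "w \<in> vertices P - F" for w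
    using ec'[of w] that vertices_subset by auto
  have hv: "z \<bullet> v + b' = \<theta>" using pos[OF v(1)] by (simp add: h v(2) q_def)
  have hw: "\<theta> \<le> z \<bullet> w + b'" if w: "w \<in> vertices P - F" for w
  proof -
    have "q w \<le> g" unfolding g_def using fin w by (intro Max_ge) auto
    then show ?thesis using pos[OF w] by (simp add: h q_def divide_le_eq)
  qed
  have hF: "z \<bullet> x + b' = p \<bullet> x + b" if "x \<in> F" for x using ec[OF that] by (simp add: h)
  have pF: "p \<in> dirspace F" and nF: "\<And>v. v \<in> vertices F \<Longrightarrow> 0 \<le> p \<bullet> v + b"
    and aF: "affine hull {v \<in> vertices F. p \<bullet> v + b \<le> 1} = affine hull F"
    using slab by (auto simp: slab_def)
  have vF: "vertices F = vertices P \<inter> F" using vertices_face[OF FP] .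
  have FsP: "F \<subseteq> P" using FP face_of_imp_subset by blast
  have zd: "z \<in> dirspace P"
    unfolding z_def using pF dirspace_mono[OF FsP] e subspace_dirspace
    by (meson subspace_add subspace_scale subsetD)
  have nn: "0 \<le> z \<bullet> w + b'" if "w \<in> vertices P" for w
    using hw[of w] hF[of w] nF[of w] \<theta> that vF by (cases "w \<in> F") auto
  let ?T = "{v \<in> vertices P. z \<bullet> v + b' \<le> 1}"
  have "affine hull ?T = affine hull P"
  proof
    show "affine hull ?T \<subseteq> affine hull P" using vertices_subset by (intro hull_mono) blast
    have "{v \<in> vertices F. p \<bullet> v + b \<le> 1} \<subseteq> ?T" using hF vF by auto
    then have 1: "affine hull F \<subseteq> affine hull ?T" unfolding aF[symmetric] by (rule hull_mono)
    have 2: "v \<in> affine hull ?T" using v hv \<theta> by (intro hull_inc) auto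
    have "F \<subseteq> affine hull ?T" using 1 hull_subset[of F affine] by blast
    then have 3: "affine hull (insert v F) \<subseteq> affine hull ?T"
      using 2 by (simp add: hull_minimal)
    have "v \<notin> affine hull F"
      using face_of_imp_eq_affine_Int[OF polytope_imp_convex[OF P] FP] v vertices_subset by blast
    then have "aff_dim (insert v F) = aff_dim P"
      using F by (simp add: aff_dim_insert facet_of_def)
    then have "affine hull (insert v F) = affine hull P"
      using aff_dim_eq_full_gen[of "insert v F" P] FsP v vertices_subset by blast
    then show "affine hull P \<subseteq> affine hull ?T" using 3 by simp
  qed
  then have "slab P z b'" using zd nn by (simp add: slab_def)
  moreover have "(z - p) \<bullet> y = 0" if "y \<in> dirspace F" for y
    using e0[OF that] by (simp add: z_def)
  ultimately show ?thesis using that[of z b' v] hF v(1) hv hw by blast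
qed

section \<open>Growth of the gradient along a flag of faces\<close>

lemma norm_orthogonal_extension:
  fixes p z :: "'a::euclidean_space"
  assumes "p \<in> dirspace F" "\<And>y. y \<in> dirspace F \<Longrightarrow> (z - p) \<bullet> y = 0"
  shows "(norm z)\<^sup>2 = (norm p)\<^sup>2 + (norm (z - p))\<^sup>2"
proof -
  have "(z - p) \<bullet> p = 0" using assms by blast
  then have "orthogonal p (z - p)" by (simp add: orthogonal_def inner_commute)
  then show ?thesis using norm_add_Pythagorean[of p "z - p"] by simp
qed

text \<open>The diamond property. \<open>F\<close> is the intersection of the facets containing it,
  so one of them, \<open>H\<close>, does not contain \<open>G\<close>. Then
  \<open>G \<inter> H\<close> is a proper face of \<open>G\<close> containing the facet
  \<open>F\<close> of \<open>G\<close>, and dimension forces equality.\<close>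

lemma second_facet:
  fixes P :: "'a::euclidean_space set"
  assumes P: "polytope P" and G: "G facet_of P" and F: "F facet_of G"
  obtains H where "H facet_of P" "F facet_of H" "G \<inter> H = F"
proof -
  have GP: "G face_of P" and FG: "F face_of G" using G F facet_of_imp_face_of by auto
  have FP: "F face_of P" using FG GP face_of_trans by blast
  have dims: "aff_dim F = aff_dim G - 1" "aff_dim G = aff_dim P - 1" "F \<noteq> {}"
    using G F by (auto simp: facet_of_def)
  have "F = \<Inter>{K. K facet_of P \<and> F \<subseteq> K}"
    using face_of_polyhedron[OF polytope_imp_polyhedron[OF P] FP] dims by force
  moreover have "F \<noteq> G" using dims by auto
  moreover have "F \<subseteq> G" using FG face_of_imp_subset by blast
  ultimately obtain H where H: "H facet_of P" "F \<subseteq> H" "\<not> G \<subseteq> H" by blast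
  have HP: "H face_of P" using H facet_of_imp_face_of by blast
  have GH: "G \<inter> H face_of G"
    using face_of_face[OF GP] face_of_Int[OF GP HP] by blast
  have "aff_dim (G \<inter> H) < aff_dim G"
    using face_of_aff_dim_lt[OF face_of_imp_convex[OF GP] GH] H by blast
  moreover have "F face_of (G \<inter> H)" using FP H FG
    by (meson GH Int_subset_iff face_of_face face_of_imp_subset face_of_subset)
  ultimately have "F = G \<inter> H"
    using face_of_aff_dim_lt[OF face_of_imp_convex[OF GH], of F] dims by force
  moreover have "F face_of H" using FP H by (meson HP face_of_face)
  then have "F facet_of H" using dims H by (auto simp: facet_of_def)
  ultimately show ?thesis using that H by blast
qed

text \<open>One competitor vanishes at \<open>a1\<close> in \<open>G - F\<close> and is at least
  \<open>1\<close> off \<open>G\<close>, thus at \<open>a2\<close>; the other behaves symmetrically.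
  So they rise by at least \<open>1\<close> along opposite vectors, and \<open>p\<close> does not
  increase along one of the two. For that competitor \<open>z - p\<close> alone accounts for the
  rise, over a distance at most \<open>D\<close>.\<close>

lemma slab_extend_twice:
  fixes P :: "'a::euclidean_space set"
  assumes P: "polytope P" and G: "G facet_of P" and F: "F facet_of G" and slab: "slab F p b"
    and D: "0 < D" "\<And>v w. v \<in> P \<Longrightarrow> w \<in> P \<Longrightarrow> dist v w \<le> D"
  obtains z b' where "slab P z b'" "(norm p)\<^sup>2 + 1 / D\<^sup>2 \<le> (norm z)\<^sup>2"
proof -
  obtain H where H: "H facet_of P" "F facet_of H" and GH: "G \<inter> H = F"
    using second_facet[OF P G F] .
  have pF: "p \<in> dirspace F" using slab by (simp add: slab_def)
  \<comment> \<open>The minimum \<open>0\<close> is attained at a vertex of \<open>K - F\<close>,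
    which keeps its value in the second extension; the minimum \<open>1\<close> bounds all vertices
    off \<open>K\<close>.\<close>
  have one: "\<exists>z b' a. slab P z b' \<and> (\<forall>y \<in> dirspace F. (z - p) \<bullet> y = 0) \<and>
      a \<in> vertices P \<and> a \<in> K - F \<and> z \<bullet> a + b' = 0 \<and> (\<forall>w \<in> vertices P - K. 1 \<le> z \<bullet> w + b')"
    if K: "K facet_of P" "F facet_of K" for K
  proof -
    have KP: "K face_of P" using K facet_of_imp_face_of by blast
    have "polytope K" using P KP face_of_polytope_polytope by blast
    from slab_extend[OF this K(2) slab, of 0]
    obtain z b' v where z: "slab K z b'" "\<And>y. y \<in> dirspace F \<Longrightarrow> (z - p) \<bullet> y = 0"
      "v \<in> vertices K - F" "z \<bullet> v + b' = 0" by (metis order_refl zero_le_one)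
    from slab_extend[OF P K(1) z(1), of 1]
    obtain z' b'' where z': "slab P z' b''" "\<And>y. y \<in> dirspace K \<Longrightarrow> (z' - z) \<bullet> y = 0"
      "\<And>x. x \<in> K \<Longrightarrow> z' \<bullet> x + b'' = z \<bullet> x + b'"
      "\<And>w. w \<in> vertices P - K \<Longrightarrow> 1 \<le> z' \<bullet> w + b''" by (metis order_refl zero_le_one)
    have "(z' - p) \<bullet> y = 0" if y: "y \<in> dirspace F" for y
    proof -
      have "y \<in> dirspace K" using y dirspace_mono K(2) facet_of_imp_subset by blast
      then show ?thesis using z'(2)[of y] z(2)[OF y] by (simp add: inner_diff_left)
    qed
    moreover have "v \<in> vertices P" "v \<in> K - F"
      using z(3) vertices_face[OF KP] by auto
    moreover have "z' \<bullet> v + b'' = 0" using z'(3)[of v] z(3,4) vertices_face[OF KP] by auto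
    ultimately show ?thesis using z'(1,4) by blast
  qed
  obtain z1 b1 a1 where 1: "slab P z1 b1" "\<And>y. y \<in> dirspace F \<Longrightarrow> (z1 - p) \<bullet> y = 0"
    "a1 \<in> vertices P" "a1 \<in> G - F" "z1 \<bullet> a1 + b1 = 0" "\<And>w. w \<in> vertices P - G \<Longrightarrow> 1 \<le> z1 \<bullet> w + b1"
    using one[OF G F] by blast
  obtain z2 b2 a2 where 2: "slab P z2 b2" "\<And>y. y \<in> dirspace F \<Longrightarrow> (z2 - p) \<bullet> y = 0"
    "a2 \<in> vertices P" "a2 \<in> H - F" "z2 \<bullet> a2 + b2 = 0" "\<And>w. w \<in> vertices P - H \<Longrightarrow> 1 \<le> z2 \<bullet> w + b2"
    using one[OF H] by blast
  have ge1: "1 \<le> z1 \<bullet> (a2 - a1)" "1 \<le> z2 \<bullet> (a1 - a2)"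
    using 1(5) 1(6)[of a2] 2(5) 2(6)[of a1] 1(3,4) 2(3,4) GH by (auto simp: inner_diff_right)
  have dD: "norm (a1 - a2) \<le> D"
    using D(2)[of a1 a2] 1(3) 2(3) vertices_subset by (auto simp: dist_norm)
  note obtained = that
  \<comment> \<open>\<open>h\<close> grows by at least \<open>1\<close> along \<open>c\<close> while \<open>p\<close> contributes nothing to that growth.\<close>
  have fin: ?thesis if z: "slab P z b'" "\<And>y. y \<in> dirspace F \<Longrightarrow> (z - p) \<bullet> y = 0"
    and c: "1 \<le> z \<bullet> c" "p \<bullet> c \<le> 0" "norm c \<le> D" for z b' c
  proof -
    have "1 \<le> (z - p) \<bullet> c" using c by (simp add: inner_diff_left)
    also have "\<dots> \<le> norm (z - p) * norm c" by (rule norm_cauchy_schwarz)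
    also have "\<dots> \<le> norm (z - p) * D" using c by (intro mult_left_mono) auto
    finally have "1 / D \<le> norm (z - p)" using D(1) by (simp add: divide_le_eq)
    then have "(1 / D)\<^sup>2 \<le> (norm (z - p))\<^sup>2" using D(1) by (intro power_mono) auto
    then have "(norm p)\<^sup>2 + 1 / D\<^sup>2 \<le> (norm z)\<^sup>2"
      using norm_orthogonal_extension[OF pF z(2)] by (simp add: power_divide)
    then show ?thesis using obtained[OF z(1)] by blast
  qed
  show ?thesis
  proof (cases "p \<bullet> (a2 - a1) \<le> 0")
    case True
    then show ?thesis using fin[OF 1(1,2) ge1(1)] dD by (simp add: norm_minus_commute)
  next
    case False
    then have "p \<bullet> (a1 - a2) \<le> 0" by (simp add: inner_diff_right)
    then show ?thesis using fin[OF 2(1,2) ge1(2)] dD by simp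
  qed
qed

lemma face_in_facet:
  fixes P :: "'a::euclidean_space set"
  assumes P: "polytope P" and E: "E face_of P" "E \<noteq> {}" "E \<noteq> P"
  obtains G where "G facet_of P" "E face_of G" "polytope G"
proof -
  obtain G where G: "G facet_of P" "E \<subseteq> G"
    using face_of_polyhedron_subset_facet[OF polytope_imp_polyhedron[OF P] E] .
  have GP: "G face_of P" using G facet_of_imp_face_of by blast
  then have "E face_of G" "polytope G"
    using E G face_of_face face_of_polytope_polytope[OF P] by auto
  with that G show ?thesis by blast
qed

text \<open>Induction in steps of two dimensions along a flag of faces above the edge; each step
  gains \<open>1 / D\<^sup>2\<close> by \<open>slab_extend_twice\<close>.\<close>

lemma slab_from_edge:
  fixes P :: "'a::euclidean_space set"
  assumes "polytope P" "closed_segment u w face_of P" "u \<noteq> w" "aff_dim P = 2 * int j + 1"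
    and D: "0 < D" "\<And>v w. v \<in> P \<Longrightarrow> w \<in> P \<Longrightarrow> dist v w \<le> D"
  shows "\<exists>z b. slab P z b \<and> 1 / (dist u w)\<^sup>2 + real j / D\<^sup>2 \<le> (norm z)\<^sup>2"
  using assms
proof (induction j arbitrary: P)
  case 0
  have "aff_dim (closed_segment u w) = 1"
    using \<open>u \<noteq> w\<close> by (simp add: segment_convex_hull aff_dim_convex_hull aff_dim_2)
  then have PE: "P = closed_segment u w"
    using face_of_aff_dim_lt[OF polytope_imp_convex[OF 0(1)] 0(2)] 0(4) by force
  then have V: "vertices P = {u, w}"
    by (auto simp: vertices_def extreme_point_of_segment)
  define n where "n = (norm (w - u))\<^sup>2"
  have n: "n > 0" using \<open>u \<noteq> w\<close> by (simp add: n_def)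
  \<comment> \<open>The gradient of the affine function rising from \<open>0\<close> at
    \<open>u\<close> to \<open>1\<close> at \<open>w\<close>, of length
    \<open>1 / dist u w\<close>.\<close>
  define z where "z = (1 / n) *\<^sub>R (w - u)"
  have zu: "z \<bullet> (w - u) = 1" using n by (simp add: z_def n_def power2_norm_eq_inner)
  have "z \<in> dirspace P"
    unfolding z_def using PE by (intro subspace_scale subspace_dirspace diff_in_dirspace) auto
  moreover have "{v \<in> vertices P. z \<bullet> v + - (z \<bullet> u) \<le> 1} = {u, w}"
    using zu by (auto simp: V inner_diff_right)
  moreover have "affine hull {u, w} = affine hull P"
    unfolding PE segment_convex_hull by simp
  ultimately have "slab P z (- (z \<bullet> u))"
    using zu by (auto simp: slab_def V inner_diff_right)
  moreover have "(norm z)\<^sup>2 = 1 / (dist u w)\<^sup>2"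
  proof -
    have "(norm z)\<^sup>2 = (1 / n)\<^sup>2 * n" by (simp add: z_def n_def power_mult_distrib power_divide)
    also have "\<dots> = 1 / n" using n by (simp add: power2_eq_square)
    finally show ?thesis by (simp add: n_def dist_norm norm_minus_commute)
  qed
  ultimately show ?case by (intro exI conjI) auto
next
  case (Suc j)
  let ?E = "closed_segment u w"
  have dE: "aff_dim ?E = 1" "?E \<noteq> {}"
    using \<open>u \<noteq> w\<close> by (auto simp: segment_convex_hull aff_dim_convex_hull aff_dim_2)
  then have "?E \<noteq> P" using Suc.prems(4) by auto
  then obtain G where G: "G facet_of P" "?E face_of G" "polytope G"
    using face_in_facet[OF Suc.prems(1,2) dE(2)] by blast
  have dG: "aff_dim G = 2 * int j + 2" using G Suc.prems(4) by (simp add: facet_of_def)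
  then have "?E \<noteq> G" using dE by auto
  then obtain F where F: "F facet_of G" "?E face_of F" "polytope F"
    using face_in_facet[OF G(3,2) dE(2)] by blast
  have dF: "aff_dim F = 2 * int j + 1" using F dG by (simp add: facet_of_def)
  have "F \<subseteq> P" using F G facet_of_imp_subset by blast
  then have "\<exists>z b. slab F z b \<and> 1 / (dist u w)\<^sup>2 + real j / D\<^sup>2 \<le> (norm z)\<^sup>2"
    using Suc.IH[OF F(3,2) Suc.prems(3) dF Suc.prems(5)] Suc.prems(6) by blast
  then obtain p b where p: "slab F p b" "1 / (dist u w)\<^sup>2 + real j / D\<^sup>2 \<le> (norm p)\<^sup>2" by blast
  obtain z b' where "slab P z b'" "(norm p)\<^sup>2 + 1 / D\<^sup>2 \<le> (norm z)\<^sup>2"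
    using slab_extend_twice[OF Suc.prems(1) G(1) F(1) p(1) Suc.prems(5,6)] by blast
  then show ?case using p(2) by (intro exI[of _ z] exI[of _ b']) (auto simp: add_divide_distrib)
qed

text \<open>The extensions with minimum \<open>0\<close> and minimum \<open>1\<close> agree at
  \<open>c\<close> but differ by at least \<open>1\<close> at the vertex \<open>v\<close> where the
  first vanishes. Hence their gradients are at least \<open>1 / sqrt H\<close> apart, and one of
  them is at least half that far from \<open>p\<close>.\<close>

lemma slab_extend_once:
  fixes P :: "'a::euclidean_space set"
  assumes P: "polytope P" and F: "F facet_of P" and slab: "slab F p b"
    and c: "c \<in> F" and H: "\<And>v. v \<in> vertices P \<Longrightarrow> (dist v c)\<^sup>2 \<le> H" "0 < H"
  obtains z b' where "slab P z b'" "(norm p)\<^sup>2 + 1 / (4 * H) \<le> (norm z)\<^sup>2"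
proof -
  have pF: "p \<in> dirspace F" using slab by (simp add: slab_def)
  obtain z0 b0 v where 0: "slab P z0 b0" "\<And>y. y \<in> dirspace F \<Longrightarrow> (z0 - p) \<bullet> y = 0"
    "\<And>x. x \<in> F \<Longrightarrow> z0 \<bullet> x + b0 = p \<bullet> x + b" "v \<in> vertices P - F" "z0 \<bullet> v + b0 = 0"
    using slab_extend[OF P F slab, of 0] by (metis order_refl zero_le_one)
  obtain z1 b1 where 1: "slab P z1 b1" "\<And>y. y \<in> dirspace F \<Longrightarrow> (z1 - p) \<bullet> y = 0"
    "\<And>x. x \<in> F \<Longrightarrow> z1 \<bullet> x + b1 = p \<bullet> x + b" "\<And>w. w \<in> vertices P - F \<Longrightarrow> 1 \<le> z1 \<bullet> w + b1"
    using slab_extend[OF P F slab, of 1] by (metis order_refl zero_le_one)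
  have "1 \<le> (z1 - z0) \<bullet> (v - c)"
    using 1(4)[OF 0(4)] 0(5) 0(3)[OF c] 1(3)[OF c]
    by (simp add: inner_diff_left inner_diff_right)
  also have "\<dots> \<le> norm (z1 - z0) * norm (v - c)" by (rule norm_cauchy_schwarz)
  also have "\<dots> \<le> (norm (z1 - p) + norm (z0 - p)) * sqrt H"
  proof (intro mult_mono)
    show "norm (z1 - z0) \<le> norm (z1 - p) + norm (z0 - p)"
      using norm_triangle_ineq4[of "z1 - p" "z0 - p"] by simp
    show "norm (v - c) \<le> sqrt H"
      using H(1)[of v] 0(4) by (auto simp: dist_norm intro: real_le_rsqrt)
  qed auto
  finally have *: "1 / sqrt H \<le> norm (z1 - p) + norm (z0 - p)"
    using H(2) by (simp add: divide_le_eq)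
  note obtained = that
  have fin: ?thesis if z: "slab P z b'" "\<And>y. y \<in> dirspace F \<Longrightarrow> (z - p) \<bullet> y = 0"
    and half: "1 / sqrt H / 2 \<le> norm (z - p)" for z b'
  proof -
    have "(1 / sqrt H / 2)\<^sup>2 \<le> (norm (z - p))\<^sup>2" using half H(2) by (intro power_mono) auto
    then have "(norm p)\<^sup>2 + 1 / (4 * H) \<le> (norm z)\<^sup>2"
      using norm_orthogonal_extension[OF pF z(2)] H(2) by (simp add: power_divide mult.commute)
    then show ?thesis using obtained[OF z(1)] by blast
  qed
  show ?thesis
  proof (cases "1 / sqrt H / 2 \<le> norm (z1 - p)")
    case True then show ?thesis using fin[OF 1(1,2)] by blast
  next
    case False
    then have "1 / sqrt H / 2 \<le> norm (z0 - p)" using * by linarith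
    then show ?thesis using fin[OF 0(1,2)] by blast
  qed
qed

section \<open>Short edges and the circumradius\<close>

lemma extreme_point_combination:
  assumes w: "w extreme_point_of P" and P: "k \<in> P" "y \<in> P"
    and eq: "w = l *\<^sub>R k + (1 - l) *\<^sub>R y" and l: "0 < l" "l \<le> 1"
  shows "k = w"
proof (rule ccontr)
  assume ne: "k \<noteq> w"
  then have "l \<noteq> 1" using eq by auto
  moreover have "k \<noteq> y" using ne eq by (auto simp: algebra_simps)
  ultimately have "w \<in> open_segment k y"
    using eq l by (auto simp: in_segment intro!: exI[of _ "1 - l"])
  then show False using w P by (auto simp: extreme_point_of_def)
qed

text \<open>\<open>v\<close> is the strict minimum of \<open>k\<close>, and \<open>w\<close> is
  lowest among the rest, possibly with ties. If a mixture of \<open>a\<close> and \<open>b\<close>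
  lies on the segment, \<open>k\<close> bounds the weight falling outside \<open>v\<close>, so
  \<open>w\<close> becomes a convex combination of \<open>v\<close> and points of \<open>?K\<close>;
  extremality of \<open>w\<close> then puts \<open>a\<close> and \<open>b\<close> on the
  segment.\<close>

lemma minimal_vertex_edge:
  fixes P :: "'a::euclidean_space set"
  assumes P: "polytope P" and v: "v \<in> vertices P" and w: "w \<in> vertices P" "w \<noteq> v"
    and low: "k \<bullet> v < k \<bullet> w" and min: "\<And>x. x \<in> vertices P \<Longrightarrow> x \<noteq> v \<Longrightarrow> k \<bullet> w \<le> k \<bullet> x"
  shows "closed_segment v w face_of P"
proof -
  let ?K = "convex hull (vertices P - {v})"
  have convP: "convex P" using P polytope_imp_convex by blast
  have vP: "v \<in> P" and wP: "w \<in> P" using v w vertices_subset by auto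
  have wext: "w extreme_point_of P" using w by (simp add: vertices_def)
  have KP: "?K \<subseteq> P" using convex_hull_vertices[OF P] hull_mono[of "vertices P - {v}" "vertices P" convex] by blast
  have Kk: "k \<bullet> w \<le> k \<bullet> x" if "x \<in> ?K" for x
  proof -
    have "?K \<subseteq> {x. k \<bullet> x \<ge> k \<bullet> w}" using min by (intro hull_minimal convex_halfspace_ge) auto
    then show ?thesis using that by blast
  qed
  have "P = convex hull (insert v (vertices P - {v}))"
    using convex_hull_vertices[OF P] v by (simp add: insert_absorb)
  also have "\<dots> = {x. \<exists>u\<ge>0. \<exists>t\<ge>0. \<exists>b. u + t = 1 \<and> b \<in> ?K \<and> x = u *\<^sub>R v + t *\<^sub>R b}"
    using w by (intro convex_hull_insert) auto
  finally have Pe: "P = {x. \<exists>u\<ge>0. \<exists>t\<ge>0. \<exists>b. u + t = 1 \<and> b \<in> ?K \<and> x = u *\<^sub>R v + t *\<^sub>R b}" .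
  have repr: "\<exists>\<alpha> y. 0 \<le> \<alpha> \<and> \<alpha> \<le> 1 \<and> y \<in> ?K \<and> a = (1 - \<alpha>) *\<^sub>R v + \<alpha> *\<^sub>R y" if "a \<in> P" for a
  proof -
    have "a \<in> {x. \<exists>u\<ge>0. \<exists>t\<ge>0. \<exists>b. u + t = 1 \<and> b \<in> ?K \<and> x = u *\<^sub>R v + t *\<^sub>R b}"
      using that Pe by simp
    then obtain u t b where "0 \<le> u" "0 \<le> t" "u + t = 1" "b \<in> ?K" "a = u *\<^sub>R v + t *\<^sub>R b" by blast
    then show ?thesis by (intro exI[of _ t] exI[of _ b]) (auto simp: eq_diff_eq[symmetric])
  qed
  have one: "a \<in> closed_segment v w"
    if ab: "a \<in> P" "b \<in> P" and t: "0 < t" "t < 1"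
      and x: "(1 - t) *\<^sub>R a + t *\<^sub>R b = (1 - s) *\<^sub>R v + s *\<^sub>R w" and s: "0 \<le> s" "s \<le> 1" for a b t s
  proof -
    obtain \<alpha> y where \<alpha>: "0 \<le> \<alpha>" "\<alpha> \<le> 1" and y: "y \<in> ?K" and ae: "a = (1 - \<alpha>) *\<^sub>R v + \<alpha> *\<^sub>R y"
      using repr[OF ab(1)] by blast
    obtain \<beta> y' where \<beta>: "0 \<le> \<beta>" "\<beta> \<le> 1" and y': "y' \<in> ?K" and be: "b = (1 - \<beta>) *\<^sub>R v + \<beta> *\<^sub>R y'"
      using repr[OF ab(2)] by blast
    define A where "A = (1 - t) * \<alpha>"
    define B where "B = t * \<beta>"
    have AB: "0 \<le> A" "0 \<le> B" using t \<alpha> \<beta> by (auto simp: A_def B_def)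
    have lhs: "(1 - t) *\<^sub>R a + t *\<^sub>R b = (1 - A - B) *\<^sub>R v + A *\<^sub>R y + B *\<^sub>R y'"
    proof -
      have "(1 - t) *\<^sub>R a = ((1 - t) - A) *\<^sub>R v + A *\<^sub>R y"
        by (simp add: ae A_def scaleR_add_right right_diff_distrib)
      moreover have "t *\<^sub>R b = (t - B) *\<^sub>R v + B *\<^sub>R y'"
        by (simp add: be B_def scaleR_add_right right_diff_distrib)
      moreover have "((1 - t) - A) *\<^sub>R v + (t - B) *\<^sub>R v = (1 - A - B) *\<^sub>R v"
        by (simp add: scaleR_add_left[symmetric])
      ultimately show ?thesis by (metis (no_types, lifting) add.assoc add.commute)
    qed
    have sw: "s *\<^sub>R w = (s - A - B) *\<^sub>R v + A *\<^sub>R y + B *\<^sub>R y'"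
      using x unfolding lhs by (simp add: algebra_simps)
    have "s * (k \<bullet> w) = (s - A - B) * (k \<bullet> v) + A * (k \<bullet> y) + B * (k \<bullet> y')"
      using arg_cong[OF sw, of "\<lambda>x. k \<bullet> x"] by (simp add: inner_add_right)
    moreover have "A * (k \<bullet> w) \<le> A * (k \<bullet> y)" "B * (k \<bullet> w) \<le> B * (k \<bullet> y')"
      using Kk[OF y] Kk[OF y'] AB by (auto intro: mult_left_mono)
    ultimately have "(s - A - B) * (k \<bullet> v) \<le> (s - A - B) * (k \<bullet> w)"
      by (simp add: algebra_simps)
    \<comment> \<open>A negative \<open>s - A - B\<close> would contradict
      \<open>k \<bullet> v < k \<bullet> w\<close>, so all coefficients in \<open>sw\<close> are
      nonnegative.\<close>
    then have sAB: "A + B \<le> s" using low by (simp add: mult_le_cancel_left)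
    show ?thesis
    proof (cases "\<alpha> = 0")
      case True then show ?thesis by (simp add: ae)
    next
      case False
      then have A0: "A > 0" using t \<alpha> by (simp add: A_def)
      then have s0: "s > 0" using sAB AB by simp
      have "y = w"
      proof (cases "A = s")
        case True
        then have "B = 0" using sAB AB by simp
        then show ?thesis using sw True s0 by simp
      next
        case neq: False
        \<comment> \<open>\<open>q\<close> collects all terms besides \<open>y\<close>, which leaves
          \<open>w\<close> as a mixture of two points of \<open>P\<close>.\<close>
        define q where "q = ((s - A - B) / (s - A)) *\<^sub>R v + (B / (s - A)) *\<^sub>R y'"
        have sA: "s - A > 0" using neq sAB AB by simp
        have "(s - A - B) / (s - A) + B / (s - A) = 1" using sA by (simp add: add_divide_distrib[symmetric])
        moreover have "0 \<le> (s - A - B) / (s - A)" "0 \<le> B / (s - A)" using sA sAB AB by auto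
        ultimately have qP: "q \<in> P"
          unfolding q_def using convexD[OF convP vP] y' KP by blast
        have "(s - A) *\<^sub>R q = (s - A - B) *\<^sub>R v + B *\<^sub>R y'"
          using sA by (simp add: q_def scaleR_add_right)
        then have "s *\<^sub>R w = A *\<^sub>R y + (s - A) *\<^sub>R q" using sw by (simp add: add.commute add.left_commute)
        then have "(1 / s) *\<^sub>R (s *\<^sub>R w) = (1 / s) *\<^sub>R (A *\<^sub>R y + (s - A) *\<^sub>R q)" by simp
        then have "w = (A / s) *\<^sub>R y + (1 - A / s) *\<^sub>R q"
          using s0 by (simp add: scaleR_add_right diff_divide_distrib)
        then show ?thesis
          using extreme_point_combination[OF wext _ qP, of y "A / s"] y KP A0 s0 sAB AB by auto
      qed
      then show ?thesis using \<alpha> by (auto simp: ae in_segment)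
    qed
  qed
  show ?thesis
    unfolding face_of_def
  proof (intro conjI ballI impI)
    show "closed_segment v w \<subseteq> P" using closed_segment_subset[OF vP wP convP] .
    fix a b x assume ab: "a \<in> P" "b \<in> P" and x: "x \<in> closed_segment v w" "x \<in> open_segment a b"
    obtain s where s: "0 \<le> s" "s \<le> 1" "x = (1 - s) *\<^sub>R v + s *\<^sub>R w" using x by (auto simp: in_segment)
    obtain t where t: "0 < t" "t < 1" "x = (1 - t) *\<^sub>R a + t *\<^sub>R b" using x by (auto simp: in_segment)
    show "a \<in> closed_segment v w" using one[OF ab t(1,2) _ s(1,2)] s(3) t(3) by simp
    show "b \<in> closed_segment v w"
      using one[OF ab(2,1), of "1 - t" s] s t by (simp add: add.commute)
  qed simp
qed

lemma vertex_not_in_hull: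
  fixes P :: "'a::euclidean_space set"
  assumes P: "polytope P" and v: "v \<in> vertices P"
  shows "v \<notin> convex hull (vertices P - {v})"
proof -
  have "convex (P - {v})"
    using v extreme_point_of_stillconvex[OF polytope_imp_convex[OF P]] by (simp add: vertices_def)
  then have "convex hull (vertices P - {v}) \<subseteq> P - {v}"
    using vertices_subset by (intro hull_minimal) blast+
  then show ?thesis by blast
qed

text \<open>A pivot of the simplex method. If \<open>v\<close> is the strict minimum of
  \<open>k\<close>, the lowest other vertex is a neighbour. Otherwise tilt \<open>k\<close> until
  \<open>v\<close> is minimal but not strictly so; on the face \<open>G\<close> of minimisers no
  vertex exceeds \<open>v\<close> in \<open>k\<close>, and \<open>\<kappa>\<close> selects a
  neighbour of \<open>v\<close> inside \<open>G\<close>.\<close>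

lemma vertex_edge:
  fixes P :: "'a::euclidean_space set"
  assumes P: "polytope P" and v: "v \<in> vertices P" and w: "w \<in> vertices P" "w \<noteq> v"
    and M: "k \<bullet> v \<le> M" "k \<bullet> w \<le> M"
  obtains u where "u \<in> vertices P" "u \<noteq> v" "closed_segment v u face_of P" "k \<bullet> u \<le> M"
proof (cases "\<forall>x \<in> vertices P - {v}. k \<bullet> v < k \<bullet> x")
  case True
  have "finite (vertices P - {v})" "vertices P - {v} \<noteq> {}" using finite_vertices[OF P] w by auto
  then obtain u where u: "u \<in> vertices P - {v}" "\<And>x. x \<in> vertices P - {v} \<Longrightarrow> k \<bullet> u \<le> k \<bullet> x"
    using arg_min_if_finite[of "vertices P - {v}" "\<lambda>x. k \<bullet> x"] by (meson not_le_imp_less)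
  have "closed_segment v u face_of P"
    using u True by (intro minimal_vertex_edge[OF P v]) auto
  then show ?thesis using that u u(2)[of w] w M by force
next
  case False
  then obtain x0 where x0: "x0 \<in> vertices P - {v}" "k \<bullet> x0 \<le> k \<bullet> v" by force
  obtain \<kappa> b where \<kappa>: "\<kappa> \<bullet> v < b" "\<And>x. x \<in> convex hull (vertices P - {v}) \<Longrightarrow> b < \<kappa> \<bullet> x"
    using separating_hyperplane_closed_point[of "convex hull (vertices P - {v})" v]
      vertex_not_in_hull[OF P v] finite_vertices[OF P]
    by (metis convex_convex_hull compact_imp_closed finite_Diff finite_imp_compact_convex_hull)
  have pos: "0 < \<kappa> \<bullet> x - \<kappa> \<bullet> v" if "x \<in> vertices P - {v}" for x
    using \<kappa>(1) \<kappa>(2)[OF hull_inc[OF that]] by simp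
  \<comment> \<open>The slope of \<open>k\<close> along \<open>x - v\<close> relative to
    \<open>\<kappa>\<close>; the smallest slope is the tilt that just makes \<open>v\<close>
    minimal.\<close>
  define r where "r x = (k \<bullet> x - k \<bullet> v) / (\<kappa> \<bullet> x - \<kappa> \<bullet> v)" for x
  have "finite (vertices P - {v})" "vertices P - {v} \<noteq> {}" using finite_vertices[OF P] w by auto
  then obtain y where y: "y \<in> vertices P - {v}" "\<And>x. x \<in> vertices P - {v} \<Longrightarrow> r y \<le> r x"
    using arg_min_if_finite[of "vertices P - {v}" r] by (meson not_le_imp_less)
  have ry: "r y \<le> 0"
  proof -
    have "r x0 \<le> 0" using x0(2) pos[OF x0(1)] by (simp add: r_def divide_le_0_iff)
    then show ?thesis using y(2)[OF x0(1)] by simp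
  qed
  define a where "a = k - r y *\<^sub>R \<kappa>"
  have ax: "a \<bullet> x - a \<bullet> v = (r x - r y) * (\<kappa> \<bullet> x - \<kappa> \<bullet> v)" if "x \<in> vertices P - {v}" for x
  proof -
    have "r x * (\<kappa> \<bullet> x - \<kappa> \<bullet> v) = k \<bullet> x - k \<bullet> v" using pos[OF that] by (simp add: r_def)
    then show ?thesis by (simp add: a_def inner_diff_left left_diff_distrib right_diff_distrib)
  qed
  have av: "a \<bullet> v \<le> a \<bullet> x" if "x \<in> vertices P" for x
  proof (cases "x = v")
    case nv: False
    then have "0 \<le> (r x - r y) * (\<kappa> \<bullet> x - \<kappa> \<bullet> v)"
      using y(2)[of x] pos[of x] that by (intro mult_nonneg_nonneg) auto
    then show ?thesis using ax[of x] that nv by simp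
  qed simp
  have "convex hull (vertices P) \<subseteq> {x. a \<bullet> x \<ge> a \<bullet> v}"
    using av by (intro hull_minimal convex_halfspace_ge) auto
  then have aP: "a \<bullet> v \<le> a \<bullet> x" if "x \<in> P" for x using convex_hull_vertices[OF P] that by blast
  define G where "G = P \<inter> {x. a \<bullet> x = a \<bullet> v}"
  have G: "G face_of P" unfolding G_def
    using face_of_Int_supporting_hyperplane_ge[OF polytope_imp_convex[OF P]] aP by blast
  have polG: "polytope G" using P G face_of_polytope_polytope by blast
  have VG: "vertices G = vertices P \<inter> G" using vertices_face[OF G] .
  have vG: "v \<in> vertices G" using v subsetD[OF vertices_subset v] unfolding VG by (simp add: G_def)
  have yG: "y \<in> vertices G - {v}"
    using y(1) ax[OF y(1)] subsetD[OF vertices_subset[of P], of y] unfolding VG by (simp add: G_def)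
  have "finite (vertices G - {v})" "vertices G - {v} \<noteq> {}" using finite_vertices[OF polG] yG by auto
  then obtain u where u: "u \<in> vertices G - {v}" "\<And>x. x \<in> vertices G - {v} \<Longrightarrow> \<kappa> \<bullet> u \<le> \<kappa> \<bullet> x"
    using arg_min_if_finite[of "vertices G - {v}" "\<lambda>x. \<kappa> \<bullet> x"] by (meson not_le_imp_less)
  have uP: "u \<in> vertices P - {v}" using u VG by auto
  have "closed_segment v u face_of G"
    using u pos[OF uP] by (intro minimal_vertex_edge[OF polG vG]) auto
  then have edge: "closed_segment v u face_of P" using G face_of_trans by blast
  have low: "k \<bullet> u \<le> M"
  proof -
    have "u \<in> G" using u VG by blast
    then have "a \<bullet> u = a \<bullet> v" unfolding G_def by simp
    then have "k \<bullet> u - k \<bullet> v = r y * (\<kappa> \<bullet> u - \<kappa> \<bullet> v)"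
      by (simp add: a_def inner_diff_left right_diff_distrib)
    also have "\<dots> \<le> 0" using ry pos[OF uP] by (intro mult_nonpos_nonneg) linarith+
    finally show ?thesis using M by simp
  qed
  show ?thesis by (rule that[OF _ _ edge low]) (use uP in auto)
qed

section \<open>Variance of distributions on the vertices\<close>

lemma variance_about_point:
  fixes c v :: "'a::euclidean_space"
  assumes "finite A" "sum u A = 1" "c = (\<Sum>w\<in>A. u w *\<^sub>R w)"
  shows "(\<Sum>w\<in>A. u w * (dist w v)\<^sup>2) = (dist v c)\<^sup>2 + ((\<Sum>w\<in>A. u w * (norm w)\<^sup>2) - (norm c)\<^sup>2)"
proof -
  have "(\<Sum>w\<in>A. u w * (dist w v)\<^sup>2)
      = (\<Sum>w\<in>A. u w * (norm w)\<^sup>2 - 2 * ((u w *\<^sub>R w) \<bullet> v) + u w * (norm v)\<^sup>2)"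
    by (intro sum.cong refl)
       (simp add: dist_norm power2_norm_eq_inner inner_diff_left inner_diff_right inner_commute algebra_simps)
  also have "\<dots> = (\<Sum>w\<in>A. u w * (norm w)\<^sup>2) - 2 * (c \<bullet> v) + (norm v)\<^sup>2"
    using assms by (simp add: sum.distrib sum_subtractf inner_sum_left sum_distrib_left[symmetric]
        sum_distrib_right[symmetric])
  \<comment> \<open>The parallel axis identity: the bracket is the variance of the weights about
    their mean \<open>c\<close>, independent of \<open>v\<close>.\<close>
  also have "\<dots> = (dist v c)\<^sup>2 + ((\<Sum>w\<in>A. u w * (norm w)\<^sup>2) - (norm c)\<^sup>2)"
    by (simp add: dist_norm power2_norm_eq_inner inner_diff_left inner_diff_right inner_commute)
  finally show ?thesis .
qed

text \<open>A substitute for letting \<open>t\<close> tend to \<open>0\<close> in a first-order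
  optimality condition.\<close>

lemma le_zero_of_le_scaled:
  fixes A B :: real
  assumes "\<And>t. 0 < t \<Longrightarrow> t \<le> 1 \<Longrightarrow> A \<le> t * B"
  shows "A \<le> 0"
proof (rule ccontr)
  assume "\<not> A \<le> 0"
  moreover have "A \<le> B" using assms[of 1] by simp
  ultimately show False using assms[of "A / (2 * B)"] by simp
qed

text \<open>\<open>R\<close> is the squared circumradius, characterised by duality as the largest variance of a
  probability distribution on the vertices; \<open>c\<close> is the mean of an optimal distribution \<open>u\<close>.\<close>

definition variance_center :: "'a::euclidean_space set \<Rightarrow> 'a \<Rightarrow> real \<Rightarrow> bool" where
  "variance_center P c R \<longleftrightarrow> c \<in> P \<and> (\<forall>w\<in>vertices P. (dist w c)\<^sup>2 \<le> R) \<and>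
     (\<exists>u. (\<forall>w\<in>vertices P. 0 \<le> u w) \<and> sum u (vertices P) = 1 \<and>
       (\<forall>v. (\<Sum>w\<in>vertices P. u w * (dist w v)\<^sup>2) = (dist v c)\<^sup>2 + R)) \<and>
     (\<forall>u. (\<forall>w\<in>vertices P. 0 \<le> u w) \<and> sum u (vertices P) = 1 \<longrightarrow>
       (\<Sum>w\<in>vertices P. u w * (norm w)\<^sup>2) - (norm (\<Sum>w\<in>vertices P. u w *\<^sub>R w))\<^sup>2 \<le> R)"

text \<open>Lifting a vertex \<open>w\<close> to \<open>(w, (norm w)\<^sup>2)\<close> turns
  distributions into points of a compact hull and variance into a continuous function on it, so a
  maximum exists. Shifting a little mass from the optimum to a vertex \<open>w\<close> cannot
  increase the variance, and this bounds \<open>dist w c\<close>.\<close>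

lemma variance_center_exists:
  fixes P :: "'a::euclidean_space set"
  assumes P: "polytope P" "P \<noteq> {}"
  obtains c R where "variance_center P c R"
proof -
  define V where "V = vertices P"
  have fin: "finite V" unfolding V_def using finite_vertices P by blast
  have hull: "convex hull V = P" unfolding V_def using convex_hull_vertices P by blast
  then have "V \<noteq> {}" using P(2) by auto
  define l where "l w = (w, (norm w)\<^sup>2)" for w :: 'a
  have inj: "inj_on l V" by (auto simp: inj_on_def l_def)
  let ?C = "convex hull (l ` V)"
  have comp: "compact ?C" using fin by (simp add: finite_imp_compact_convex_hull)
  have "?C \<noteq> {}" using \<open>V \<noteq> {}\<close> by simp
  moreover have "continuous_on ?C (\<lambda>x. snd x - (norm (fst x))\<^sup>2)" by (intro continuous_intros)
  ultimately obtain x where x: "x \<in> ?C"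
    and max: "\<And>y. y \<in> ?C \<Longrightarrow> snd y - (norm (fst y))\<^sup>2 \<le> snd x - (norm (fst x))\<^sup>2"
    using continuous_attains_sup[OF comp] by blast
  define c where "c = fst x"
  define R where "R = snd x - (norm c)\<^sup>2"
  obtain a where a: "\<And>y. y \<in> l ` V \<Longrightarrow> 0 \<le> a y" "sum a (l ` V) = 1" "(\<Sum>y\<in>l ` V. a y *\<^sub>R y) = x"
    using x convex_hull_finite[OF finite_imageI[OF fin, of l]] by blast
  define u where "u w = a (l w)" for w
  have u0: "0 \<le> u w" if "w \<in> V" for w using a(1) that by (simp add: u_def)
  have u1: "sum u V = 1" using a(2) unfolding sum.reindex[OF inj] comp_def u_def .
  have xs: "x = (\<Sum>w\<in>V. u w *\<^sub>R l w)" using a(3) unfolding sum.reindex[OF inj] comp_def u_def by (rule sym)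
  have cs: "c = (\<Sum>w\<in>V. u w *\<^sub>R w)" by (simp add: c_def xs fst_sum l_def)
  have ss: "snd x = (\<Sum>w\<in>V. u w * (norm w)\<^sup>2)" by (simp add: xs snd_sum l_def)
  have "c \<in> P"
    unfolding hull[symmetric] cs
    by (rule convex_sum[OF fin convex_convex_hull u1 u0 hull_inc])
  moreover have "(dist w c)\<^sup>2 \<le> R" if w: "w \<in> V" for w
  proof -
    have "(dist w c)\<^sup>2 - R \<le> t * (dist w c)\<^sup>2" if t: "0 < t" "t \<le> 1" for t
    proof -
      have "(1 - t) *\<^sub>R x + t *\<^sub>R l w \<in> ?C"
        using convexD[OF convex_convex_hull x, of "l w" "1 - t" t] w t by (simp add: hull_inc)
      from max[OF this]
      have "(1 - t) * snd x + t * (norm w)\<^sup>2 - (norm ((1 - t) *\<^sub>R c + t *\<^sub>R w))\<^sup>2 \<le> R"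
        by (simp add: c_def R_def l_def)
      moreover have Ne: "(norm ((1 - t) *\<^sub>R c + t *\<^sub>R w))\<^sup>2
          = (1 - t)\<^sup>2 * (norm c)\<^sup>2 + 2 * t * (1 - t) * (c \<bullet> w) + t\<^sup>2 * (norm w)\<^sup>2"
        by (simp only: power2_norm_eq_inner inner_add_left inner_add_right inner_scaleR_left
              inner_scaleR_right inner_commute[of w c]) (simp add: power2_eq_square algebra_simps)
      have dd: "(dist w c)\<^sup>2 = (norm w)\<^sup>2 - 2 * (c \<bullet> w) + (norm c)\<^sup>2"
        by (simp add: dist_norm power2_norm_eq_inner inner_diff_left inner_diff_right inner_commute)
      \<comment> \<open>The right-hand side is the change in variance after moving mass
        \<open>t\<close> to \<open>w\<close>; its first-order coefficient in \<open>t\<close> is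
        \<open>(dist w c)\<^sup>2 - R\<close>.\<close>
      have "t * ((dist w c)\<^sup>2 - R) - t * (t * (dist w c)\<^sup>2)
          = (1 - t) * snd x + t * (norm w)\<^sup>2 - (norm ((1 - t) *\<^sub>R c + t *\<^sub>R w))\<^sup>2 - R"
        unfolding Ne dd R_def by algebra
      ultimately have "t * ((dist w c)\<^sup>2 - R) \<le> t * (t * (dist w c)\<^sup>2)" by linarith
      then show ?thesis using t by simp
    qed
    then show ?thesis using le_zero_of_le_scaled[of "(dist w c)\<^sup>2 - R" "(dist w c)\<^sup>2"] by simp
  qed
  moreover have "(\<Sum>w\<in>V. u w * (dist w v)\<^sup>2) = (dist v c)\<^sup>2 + R" for v
    using variance_about_point[OF fin u1 cs] by (simp add: R_def ss)
  moreover have "(\<Sum>w\<in>V. u' w * (norm w)\<^sup>2) - (norm (\<Sum>w\<in>V. u' w *\<^sub>R w))\<^sup>2 \<le> R"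
    if u': "\<And>w. w \<in> V \<Longrightarrow> 0 \<le> u' w" "sum u' V = 1" for u'
  proof -
    have "(\<Sum>w\<in>V. u' w *\<^sub>R l w) \<in> ?C"
      using u' by (intro convex_sum[OF fin convex_convex_hull]) (auto intro: hull_inc)
    from max[OF this] show ?thesis by (simp add: c_def R_def fst_sum snd_sum l_def)
  qed
  ultimately have "variance_center P c R"
    unfolding variance_center_def V_def[symmetric] using u0 u1 by (intro conjI) blast+
  then show ?thesis using that by blast
qed

lemma variance_center_dist_le:
  fixes P :: "'a::euclidean_space set"
  assumes c: "variance_center P c R" and D: "\<And>w. w \<in> vertices P \<Longrightarrow> dist v w \<le> D"
  shows "(dist v c)\<^sup>2 + R \<le> D\<^sup>2"
proof -
  obtain u where u0: "\<And>w. w \<in> vertices P \<Longrightarrow> 0 \<le> u w" and u1: "sum u (vertices P) = 1"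
    and var: "\<And>v. (\<Sum>w\<in>vertices P. u w * (dist w v)\<^sup>2) = (dist v c)\<^sup>2 + R"
    using c unfolding variance_center_def by blast
  have "(\<Sum>w\<in>vertices P. u w * (dist w v)\<^sup>2) \<le> (\<Sum>w\<in>vertices P. u w * D\<^sup>2)"
    using u0 D by (intro sum_mono mult_left_mono power_mono) (auto simp: dist_commute)
  then show ?thesis by (simp add: var sum_distrib_right[symmetric] u1)
qed

text \<open>For a vertex \<open>v\<close> of positive weight the zero distance to itself makes the
  averaged bound strict. A second average, now over \<open>v\<close> with the same weights, turns
  \<open>(dist v c)\<^sup>2 + R\<close> into \<open>2 * R\<close>.\<close>

lemma variance_center_less:
  fixes P :: "'a::euclidean_space set"
  assumes P: "polytope P" and c: "variance_center P c R" and D: "0 < D"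
    "\<And>v w. v \<in> vertices P \<Longrightarrow> w \<in> vertices P \<Longrightarrow> dist v w \<le> D"
  shows "2 * R < D\<^sup>2"
proof -
  obtain u where u0: "\<And>w. w \<in> vertices P \<Longrightarrow> 0 \<le> u w" and u1: "sum u (vertices P) = 1"
    and var: "\<And>v. (\<Sum>w\<in>vertices P. u w * (dist w v)\<^sup>2) = (dist v c)\<^sup>2 + R"
    using c unfolding variance_center_def by blast
  have fin: "finite (vertices P)" using finite_vertices P by blast
  have less: "(dist v c)\<^sup>2 + R \<le> (1 - u v) * D\<^sup>2" if v: "v \<in> vertices P" for v
  proof -
    have "(\<Sum>w\<in>vertices P. u w * (dist w v)\<^sup>2) = (\<Sum>w\<in>vertices P - {v}. u w * (dist w v)\<^sup>2)"
      using fin v by (simp add: sum.remove)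
    also have "\<dots> \<le> (\<Sum>w\<in>vertices P - {v}. u w * D\<^sup>2)"
      using u0 v D by (intro sum_mono mult_left_mono power_mono) auto
    also have "\<dots> = (1 - u v) * D\<^sup>2"
      using sum.remove[OF fin v, of u] u1 by (simp add: sum_distrib_right[symmetric])
    finally show ?thesis by (simp add: var)
  qed
  obtain v where v: "v \<in> vertices P" "0 < u v"
    using u0 u1 sum_nonpos[of "vertices P" u] by (metis not_less not_one_le_zero)
  have "0 < (\<Sum>w\<in>vertices P. u w * (D\<^sup>2 - ((dist w c)\<^sup>2 + R)))"
  proof (rule sum_pos2[OF fin v(1)])
    have "(1 - u v) * D\<^sup>2 < D\<^sup>2" using v(2) D(1) by simp
    then show "0 < u v * (D\<^sup>2 - ((dist v c)\<^sup>2 + R))" using less[OF v(1)] v(2) by simp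
    show "0 \<le> u w * (D\<^sup>2 - ((dist w c)\<^sup>2 + R))" if "w \<in> vertices P" for w
      using variance_center_dist_le[OF c, of w D] D(2) that u0 by simp
  qed
  also have "\<dots> = (\<Sum>w\<in>vertices P. u w * (D\<^sup>2 - R)) - (\<Sum>w\<in>vertices P. u w * (dist w c)\<^sup>2)"
    by (simp add: sum_subtractf[symmetric] right_diff_distrib) (simp add: algebra_simps)
  also have "\<dots> = D\<^sup>2 - 2 * R"
    using var[of c] by (simp add: sum_distrib_right[symmetric] u1)
  finally show ?thesis by simp
qed

text \<open>By Caratheodory some vertex \<open>v\<close> is superfluous for representing \<open>c\<close>, so \<open>v\<close> has a neighbour on
  its own side of the hyperplane through \<open>c\<close> orthogonal to \<open>c - v\<close>.\<close>

lemma nonsimplex_short_edge: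
  fixes P :: "'a::euclidean_space set"
  assumes P: "polytope P" and dep: "affine_dependent (vertices P)"
    and vc: "variance_center P c R"
  obtains v u where "u \<noteq> v" "closed_segment v u face_of P" "(dist v u)\<^sup>2 \<le> 2 * R"
proof -
  have c: "c \<in> P" and R: "\<And>w. w \<in> vertices P \<Longrightarrow> (dist w c)\<^sup>2 \<le> R"
    using vc by (auto simp: variance_center_def)
  define V where "V = vertices P"
  have fin: "finite V" unfolding V_def using finite_vertices P by blast
  have "c \<in> convex hull V" unfolding V_def using convex_hull_vertices[OF P] c by simp
  then have "c \<in> {x. \<exists>S. finite S \<and> S \<subseteq> V \<and> card S \<le> aff_dim V + 1 \<and> x \<in> convex hull S}"
    by (simp only: caratheodory_aff_dim[of V, symmetric])
  then obtain S where S: "finite S" "S \<subseteq> V" "card S \<le> aff_dim V + 1" "c \<in> convex hull S"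
    by blast
  have "aff_dim V \<le> int (card V) - 1" using aff_dim_le_card[OF fin] .
  moreover have "aff_dim V \<noteq> int (card V) - 1"
    using dep affine_independent_iff_card[of V] fin by (simp add: V_def)
  ultimately have "card S < card V" using S(3) by linarith
  then have "S \<noteq> V" by auto
  then obtain v where v: "v \<in> V" "v \<notin> S" using S(2) by blast
  then have cK: "c \<in> convex hull (V - {v})"
    using S hull_mono[of S "V - {v}" convex] by blast
  define k where "k = c - v"
  have "\<exists>w \<in> V - {v}. k \<bullet> w \<le> k \<bullet> c"
  proof (rule ccontr)
    assume "\<not> ?thesis"
    then have "\<forall>w \<in> V - {v}. k \<bullet> c < k \<bullet> w" by (simp add: not_le)
    then have "convex hull (V - {v}) \<subseteq> {x. k \<bullet> x > k \<bullet> c}"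
      by (intro hull_minimal convex_halfspace_gt) auto
    then show False using cK by auto
  qed
  then obtain w where w: "w \<in> V" "w \<noteq> v" "k \<bullet> w \<le> k \<bullet> c" by blast
  have kk: "k \<bullet> c - k \<bullet> v = (dist v c)\<^sup>2"
    by (simp add: k_def inner_diff_right[symmetric] dist_norm norm_minus_commute power2_norm_eq_inner)
  then have "k \<bullet> v \<le> k \<bullet> c" by (metis diff_ge_0_iff_ge zero_le_power2)
  then obtain u where u: "u \<in> vertices P" "u \<noteq> v" "closed_segment v u face_of P" "k \<bullet> u \<le> k \<bullet> c"
    using vertex_edge[OF P, of v w k "k \<bullet> c"] v w by (auto simp: V_def)
  \<comment> \<open>The squared edge length expanded around \<open>c\<close>, with
    \<open>k = c - v\<close>; the side condition on \<open>u\<close> bounds the last term by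
    \<open>2 * (dist v c)\<^sup>2\<close>.\<close>
  have "(dist v u)\<^sup>2 = (dist u c)\<^sup>2 - (dist v c)\<^sup>2 + 2 * (k \<bullet> u - k \<bullet> v)"
    by (simp add: k_def dist_norm power2_norm_eq_inner inner_diff_left inner_diff_right inner_commute)
  also have "\<dots> \<le> R - (dist v c)\<^sup>2 + 2 * (dist v c)\<^sup>2" 
  proof (intro add_mono diff_right_mono R[OF u(1)] mult_left_mono)
    show "k \<bullet> u - k \<bullet> v \<le> (dist v c)\<^sup>2" unfolding kk[symmetric] using u(4) by (rule diff_right_mono)
  qed simp
  also have "\<dots> \<le> 2 * R" using R[of v] v(1) by (simp add: V_def)
  finally show ?thesis by (rule that[OF u(2,3)])
qed

lemma simplex_edge:
  fixes C :: "'a::euclidean_space set"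
  assumes "\<not> affine_dependent C" "v \<in> C" "w \<in> C"
  shows "closed_segment v w face_of convex hull C"
  by (rule iffD2[OF face_of_convex_hull_affine_independent[OF assms(1)]],
      rule exI[of _ "{v, w}"]) (simp add: segment_convex_hull assms)

text \<open>The bound is the squared circumradius of a regular simplex with \<open>n\<close>
  vertices and edge \<open>l\<close>. If \<open>P\<close> is not a simplex, it has an edge of
  squared length at most \<open>2 * R\<close>. In a simplex every pair of vertices spans an edge, so
  the uniform distribution has at least this variance, and \<open>R\<close> is the maximal
  variance.\<close>

lemma edge_length_circumradius:
  fixes P :: "'a::euclidean_space set"
  assumes P: "polytope P" "aff_dim P = int n - 1" "n > 0"
    and vc: "variance_center P c R"
    and l: "0 \<le> l" "\<And>v u. u \<noteq> v \<Longrightarrow> closed_segment v u face_of P \<Longrightarrow> l \<le> dist v u"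
  shows "l\<^sup>2 * (real n - 1) / (2 * real n) \<le> R"
proof (cases "affine_dependent (vertices P)")
  case True
  obtain v u where "u \<noteq> v" "closed_segment v u face_of P" "(dist v u)\<^sup>2 \<le> 2 * R"
    using nonsimplex_short_edge[OF P(1) True vc] by blast
  moreover from this have "l\<^sup>2 \<le> (dist v u)\<^sup>2" using l by (intro power_mono) auto
  ultimately have lR: "l\<^sup>2 \<le> 2 * R" by simp
  have "l\<^sup>2 * (real n - 1) / (2 * real n) = l\<^sup>2 / 2 * ((real n - 1) / real n)" by simp
  also have "\<dots> \<le> l\<^sup>2 / 2 * 1" using P(3) by (intro mult_left_mono) auto
  finally show ?thesis using lR by simp
next
  case False
  define V where "V = vertices P"
  have fin: "finite V" unfolding V_def using finite_vertices P by blast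
  have hull: "convex hull V = P" unfolding V_def using convex_hull_vertices P by blast
  have "aff_dim V = int (card V) - 1" using False affine_independent_iff_card[of V] by (simp add: V_def)
  moreover have "aff_dim V = aff_dim P" using aff_dim_convex_hull[of V] hull by simp
  ultimately have n: "card V = n" using P(2) by simp
  define c' where "c' = (\<Sum>w\<in>V. (1 / real n) *\<^sub>R w)"
  have s1: "(\<Sum>w\<in>V. 1 / real n) = 1" using n P(3) by simp
  have id: "(\<Sum>w\<in>V. 1 / real n * (dist w v)\<^sup>2) = (dist v c')\<^sup>2 + ((\<Sum>w\<in>V. 1 / real n * (norm w)\<^sup>2) - (norm c')\<^sup>2)" for v
    using variance_about_point[OF fin s1 c'_def] .
  define W where "W = (\<Sum>w\<in>V. 1 / real n * (norm w)\<^sup>2) - (norm c')\<^sup>2"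
  have WR: "W \<le> R" 
  proof -
    have "(\<Sum>w\<in>V. 1 / real n * (norm w)\<^sup>2) - (norm (\<Sum>w\<in>V. (1 / real n) *\<^sub>R w))\<^sup>2 \<le> R"
      using vc s1 unfolding variance_center_def V_def
      by (elim conjE allE[of _ "\<lambda>_. 1 / real n"]) simp
    then show ?thesis by (simp only: W_def c'_def)
  qed
  have edge: "l \<le> dist v w" if "v \<in> V" "w \<in> V" "w \<noteq> v" for v w
    using l(2)[OF that(3)] simplex_edge[of V v w] False that hull by (simp add: V_def)
  have ge: "(real n - 1) / real n * l\<^sup>2 \<le> (dist v c')\<^sup>2 + W" if v: "v \<in> V" for v
  proof -
    have "(real n - 1) / real n * l\<^sup>2 = (\<Sum>w\<in>V - {v}. 1 / real n * l\<^sup>2)"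
      using v fin n P(3) by (simp add: card_Diff_singleton of_nat_diff)
    also have "\<dots> \<le> (\<Sum>w\<in>V - {v}. 1 / real n * (dist w v)\<^sup>2)"
      using edge l(1) v by (intro sum_mono mult_left_mono power_mono) (auto simp: dist_commute)
    also have "\<dots> = (\<Sum>w\<in>V. 1 / real n * (dist w v)\<^sup>2)" using fin v by (simp add: sum.remove)
    finally show ?thesis unfolding id W_def .
  qed
  \<comment> \<open>Averaging \<open>ge\<close> over \<open>v\<close> turns its right-hand side into
    \<open>2 * W\<close>.\<close>
  have "(\<Sum>v\<in>V. 1 / real n * ((real n - 1) / real n * l\<^sup>2)) \<le> (\<Sum>v\<in>V. 1 / real n * ((dist v c')\<^sup>2 + W))"
    using ge by (intro sum_mono mult_left_mono) auto
  also have "\<dots> = (\<Sum>v\<in>V. 1 / real n * (dist v c')\<^sup>2) + (\<Sum>v\<in>V. 1 / real n) * W"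
    by (simp only: distrib_left sum.distrib sum_distrib_right)
  also have "\<dots> = 2 * W" using id[of c'] by (simp only: s1) (simp add: W_def)
  finally have "(\<Sum>v\<in>V. 1 / real n) * ((real n - 1) / real n * l\<^sup>2) \<le> 2 * W"
    by (simp only: sum_distrib_right)
  then have "(real n - 1) / real n * l\<^sup>2 \<le> 2 * R" using WR by (simp only: s1)
  then show ?thesis using P(3) by (simp add: field_simps)
qed

section \<open>The upper bound\<close>

lemma edge_endpoint_vertex:
  assumes "closed_segment v u face_of P"
  shows "v \<in> vertices P" "u \<in> vertices P"
  using extreme_point_of_face[OF assms] by (auto simp: vertices_def extreme_point_of_segment)

lemma shortest_edge_exists:
  fixes P :: "'a::euclidean_space set"
  assumes P: "polytope P" "0 < aff_dim P"
  obtains v u where "u \<noteq> v" "closed_segment v u face_of P"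
    "\<forall>v' u'. u' \<noteq> v' \<and> closed_segment v' u' face_of P \<longrightarrow> dist v u \<le> dist v' u'"
proof -
  define E where "E = {e \<in> vertices P \<times> vertices P. snd e \<noteq> fst e \<and> closed_segment (fst e) (snd e) face_of P}"
  have fin: "finite E" unfolding E_def using finite_vertices[OF P(1)] by simp
  have "vertices P \<noteq> {}" using convex_hull_vertices[OF P(1)] P(2) by auto
  then obtain v where v: "v \<in> vertices P" by blast
  have "vertices P \<noteq> {v}"
  proof
    assume "vertices P = {v}"
    then have "P = {v}" using convex_hull_vertices[OF P(1)] by simp
    then show False using P(2) by simp
  qed
  then obtain w where w: "w \<in> vertices P" "w \<noteq> v" using v by blast
  \<comment> \<open>The zero functional satisfies every height condition, so some edge at
    \<open>v\<close> results.\<close>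
  obtain u where "u \<in> vertices P" "u \<noteq> v" "closed_segment v u face_of P"
    using vertex_edge[OF P(1) v w, of 0 0] by auto
  then have "E \<noteq> {}" using v by (auto simp: E_def)
  then obtain e where e: "e \<in> E" and le: "\<And>e'. e' \<in> E \<Longrightarrow> dist (fst e) (snd e) \<le> dist (fst e') (snd e')"
    using arg_min_if_finite[OF fin, of "\<lambda>e. dist (fst e) (snd e)"] by (meson not_le_imp_less)
  show ?thesis
  proof (rule that)
    show "snd e \<noteq> fst e" "closed_segment (fst e) (snd e) face_of P" using e by (auto simp: E_def)
    show "\<forall>v' u'. u' \<noteq> v' \<and> closed_segment v' u' face_of P \<longrightarrow> dist (fst e) (snd e) \<le> dist v' u'"
    proof (intro allI impI)
      fix v' u' assume f: "u' \<noteq> v' \<and> closed_segment v' u' face_of P"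
      then have "(v', u') \<in> E" using edge_endpoint_vertex[of v' u' P] by (simp add: E_def)
      from le[OF this] show "dist (fst e) (snd e) \<le> dist v' u'" by simp
    qed
  qed
qed

text \<open>Here \<open>t\<close> stands for the squared ratio of the shortest facet edge to the
  diameter; equality holds at \<open>t = 1\<close>. As \<open>t\<close> decreases,
  \<open>1 / t\<close> gains at rate at least \<open>1\<close> and the last term loses at rate at
  most \<open>1 / 2\<close>. The difference is the slack \<open>(1 - t) / 2\<close>, which later
  forces strictness.\<close>

lemma odd_rank_estimate:
  fixes t :: real
  assumes r: "r \<ge> (1::nat)" and t: "0 < t" "t \<le> 1"
  shows "real r + real r / (2 * real r + 1) + (1 - t) / 2
       \<le> 1 / t + (real r - 1) + 1 / (4 * (1 - t * (2 * real r - 1) / (4 * real r)))"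
proof -
  define a where "a = (2 * real r - 1) / (2 * real r)"
  have a: "0 \<le> a" "a < 1" using r by (auto simp: a_def)
  have ta: "t * a \<le> 1" "0 \<le> t * a" using a t by (auto intro: mult_le_one)
  have e1: "1 / (4 * (1 - t * (2 * real r - 1) / (4 * real r))) = 1 / (4 - 2 * (t * a))"
  proof -
    have "t * (2 * real r - 1) / (4 * real r) = t * a / 2" by (simp add: a_def)
    then show ?thesis by (simp only:) (simp add: right_diff_distrib)
  qed
  have e2: "real r / (2 * real r + 1) = 1 / (4 - 2 * a)" using r by (simp add: a_def field_simps)
  have "1 / (4 - 2 * a) - 1 / (4 - 2 * (t * a)) = 2 * a * (1 - t) / ((4 - 2 * a) * (4 - 2 * (t * a)))"
    using a ta by (simp add: divide_simps) (simp add: algebra_simps)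
  also have "\<dots> \<le> 2 * (1 - t) / (2 * 2)"
  proof (rule frac_le)
    show "2 * a * (1 - t) \<le> 2 * (1 - t)" using a t by (intro mult_right_mono) auto
    show "2 * 2 \<le> (4 - 2 * a) * (4 - 2 * (t * a))" using a ta by (intro mult_mono) auto
  qed (use t in auto)
  also have "2 * (1 - t) / (2 * 2) = (1 - t) / 2" by simp
  finally have 1: "1 / (4 - 2 * a) \<le> 1 / (4 - 2 * (t * a)) + (1 - t) / 2" by linarith
  have "1 - t \<le> (1 - t) / t" using t by (simp add: le_divide_eq mult_left_le)
  also have "\<dots> = 1 / t - 1" using t by (simp add: diff_divide_distrib)
  finally have 2: "1 - t \<le> 1 / t - 1" .
  have h: "(1 - t) / 2 + (1 - t) / 2 = 1 - t" by simp
  show ?thesis unfolding e1 e2 using 1 2 h by linarith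
qed

text \<open>The function is built over the shortest edge of \<open>F\<close>, whose length enters
  the circumradius bound. The given edge is at least as long, so its slack is no larger.\<close>

lemma slab_even_dim:
  fixes P :: "'a::euclidean_space set"
  assumes P: "polytope P" and dim: "aff_dim P = 2 * int r" and r: "r \<ge> 1" and F: "F facet_of P"
    and D: "0 < D" "\<And>v w. v \<in> P \<Longrightarrow> w \<in> P \<Longrightarrow> dist v w \<le> D"
    and e: "u \<noteq> v" "closed_segment v u face_of F"
  shows "\<exists>z b. slab P z b \<and> real r + real r / (2 * real r + 1) + (1 - (dist v u)\<^sup>2 / D\<^sup>2) / 2 \<le> D\<^sup>2 * (norm z)\<^sup>2"
proof -
  have FP: "F \<subseteq> P" using F facet_of_imp_subset by blast
  have polF: "polytope F" using P F facet_of_imp_face_of face_of_polytope_polytope by blast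
  have dF: "aff_dim F = 2 * int (r - 1) + 1" "aff_dim F = int (2 * r) - 1"
    using F dim r by (auto simp: facet_of_def of_nat_diff)
  have DV: "dist a b \<le> D" if "a \<in> vertices P" "b \<in> vertices P" for a b
    using D(2)[OF subsetD[OF vertices_subset that(1)] subsetD[OF vertices_subset that(2)]] .
  have VF: "vertices F \<subseteq> vertices P" using vertices_face[of F P] F facet_of_imp_face_of by blast
  have posF: "0 < aff_dim F" using dF(2) r by simp
  obtain v' u' where e': "u' \<noteq> v'" "closed_segment v' u' face_of F"
    and short: "\<forall>v u. u \<noteq> v \<and> closed_segment v u face_of F \<longrightarrow> dist v' u' \<le> dist v u"
    by (rule shortest_edge_exists[OF polF posF])
  define l where "l = dist v' u'"
  define t where "t = l\<^sup>2 / D\<^sup>2"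
  have l0: "0 < l" using e' by (simp add: l_def)
  have lD: "l \<le> D" unfolding l_def using DV edge_endpoint_vertex[OF e'(2)] VF by blast
  have t: "0 < t" "t \<le> 1" using l0 lD D(1) by (auto simp: t_def power_mono)
  have tt: "t \<le> (dist v u)\<^sup>2 / D\<^sup>2"
    using short e l0 unfolding t_def l_def by (intro divide_right_mono power_mono) auto
  have DF: "dist a b \<le> D" if "a \<in> F" "b \<in> F" for a b using D(2) FP that by blast
  obtain p b where p: "slab F p b" "1 / l\<^sup>2 + real (r - 1) / D\<^sup>2 \<le> (norm p)\<^sup>2"
    using slab_from_edge[OF polF e'(2) e'(1)[symmetric] dF(1) D(1) DF] unfolding l_def by blast
  have "F \<noteq> {}" using F by (simp add: facet_of_def)
  then obtain c R where c: "variance_center F c R" using variance_center_exists[OF polF] by blast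
  have R1: "2 * R < D\<^sup>2" using variance_center_less[OF polF c D(1)] DV VF by blast
  have R2: "l\<^sup>2 * (2 * real r - 1) / (4 * real r) \<le> R"
    using edge_length_circumradius[OF polF dF(2) _ c, of l] short l0 r by (simp add: l_def)
  have "0 \<le> l\<^sup>2 * (2 * real r - 1) / (4 * real r)" using r by simp
  then have R0: "0 \<le> R" using R2 by linarith
  have H: "(dist w c)\<^sup>2 \<le> D\<^sup>2 - R" if "w \<in> vertices P" for w
  proof -
    have "dist w x \<le> D" if "x \<in> vertices F" for x using DV[OF \<open>w \<in> vertices P\<close>, of x] VF that by blast
    then have "(dist w c)\<^sup>2 + R \<le> D\<^sup>2" by (rule variance_center_dist_le[OF c])
    then show ?thesis by simp
  qed
  have cF: "c \<in> F" using c by (simp add: variance_center_def)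
  have posH: "0 < D\<^sup>2 - R" using R1 R0 by simp
  obtain z b' where z: "slab P z b'" "(norm p)\<^sup>2 + 1 / (4 * (D\<^sup>2 - R)) \<le> (norm z)\<^sup>2"
    using slab_extend_once[OF P F p(1) cF H posH] by blast
  have "real r + real r / (2 * real r + 1) + (1 - (dist v u)\<^sup>2 / D\<^sup>2) / 2
      \<le> real r + real r / (2 * real r + 1) + (1 - t) / 2"
    by (intro add_left_mono divide_right_mono diff_left_mono tt) simp
  also have "\<dots> \<le> 1 / t + (real r - 1) + 1 / (4 * (1 - t * (2 * real r - 1) / (4 * real r)))"
    using odd_rank_estimate[OF r t] .
  also have "\<dots> \<le> D\<^sup>2 * (1 / l\<^sup>2) + D\<^sup>2 * (real (r - 1) / D\<^sup>2) + D\<^sup>2 * (1 / (4 * (D\<^sup>2 - R)))"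
  proof (intro add_mono)
    show "1 / t \<le> D\<^sup>2 * (1 / l\<^sup>2)" by (simp add: t_def)
    show "real r - 1 \<le> D\<^sup>2 * (real (r - 1) / D\<^sup>2)" using D(1) r by (simp add: of_nat_diff)
    \<comment> \<open>The last term grows with \<open>R\<close>, so the lower bound on
      \<open>R\<close> may be inserted; \<open>R < D\<^sup>2\<close> keeps the denominators
      positive.\<close>
    have "R / D\<^sup>2 < 1" using R1 R0 D(1) by (simp add: divide_less_eq)
    moreover have "t * (2 * real r - 1) / (4 * real r) \<le> R / D\<^sup>2"
      using divide_right_mono[OF R2, of "D\<^sup>2"] by (simp add: t_def mult.commute)
    ultimately have "1 / (4 * (1 - t * (2 * real r - 1) / (4 * real r))) \<le> 1 / (4 * (1 - R / D\<^sup>2))"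
      by (intro divide_left_mono mult_left_mono mult_pos_pos) auto
    also have "\<dots> = D\<^sup>2 * (1 / (4 * (D\<^sup>2 - R)))"
    proof -
      have "1 - R / D\<^sup>2 = (D\<^sup>2 - R) / D\<^sup>2" using D(1) by (simp add: diff_divide_distrib)
      then show ?thesis by simp
    qed
    finally show "1 / (4 * (1 - t * (2 * real r - 1) / (4 * real r))) \<le> D\<^sup>2 * (1 / (4 * (D\<^sup>2 - R)))" .
  qed
  also have "\<dots> = D\<^sup>2 * (1 / l\<^sup>2 + real (r - 1) / D\<^sup>2 + 1 / (4 * (D\<^sup>2 - R)))"
    by (simp only: distrib_left)
  also have "\<dots> \<le> D\<^sup>2 * (norm z)\<^sup>2" using p(2) z(2) by (intro mult_left_mono) auto
  finally show ?thesis using z(1) by blast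
qed

lemma simplex_width_constant_odd:
  assumes "d = 2 * j + 1"
  shows "(real d + 1) / (2 * real_of_int \<lfloor>(real d + 1)\<^sup>2 / 4\<rfloor>) = 1 / (real j + 1)"
proof -
  have "(real d + 1)\<^sup>2 / 4 = real_of_int ((int j + 1)\<^sup>2)" using assms by (simp add: power2_eq_square algebra_simps)
  then have "\<lfloor>(real d + 1)\<^sup>2 / 4\<rfloor> = (int j + 1)\<^sup>2" by (simp only: floor_of_int)
  then show ?thesis using assms by (simp add: power2_eq_square divide_simps)
qed

lemma simplex_width_constant_even:
  assumes "d = 2 * r"
  shows "(real d + 1) / (2 * real_of_int \<lfloor>(real d + 1)\<^sup>2 / 4\<rfloor>) = (2 * real r + 1) / (2 * (real r * (real r + 1)))"
proof -
  \<comment> \<open>\<open>d + 1\<close> is odd, so a quarter of its square exceeds an integer by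
    \<open>1 / 4\<close>.\<close>
  have e: "(real d + 1)\<^sup>2 / 4 = real_of_int (int r * (int r + 1)) + 1 / 4"
    using assms by (simp add: power2_eq_square algebra_simps)
  have "\<lfloor>(real d + 1)\<^sup>2 / 4\<rfloor> = int r * (int r + 1)" unfolding e by (rule floor_unique) simp_all
  then show ?thesis using assms by simp
qed

text \<open>Any edge shorter than \<open>D\<close> gives strictness, not only a shortest one: for
  odd \<open>d\<close> the edge itself starts the flag, for even \<open>d\<close> it contributes the
  slack of \<open>slab_even_dim\<close>.\<close>

lemma slab_bound:
  fixes P :: "'a::euclidean_space set"
  assumes P: "polytope P" and dim: "aff_dim P = int d" and d: "d \<ge> 2"
    and D: "0 < D" "\<And>v w. v \<in> P \<Longrightarrow> w \<in> P \<Longrightarrow> dist v w \<le> D"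
    and e: "u \<noteq> v" "closed_segment v u face_of P"
    and B: "B = (real d + 1) / (2 * real_of_int \<lfloor>(real d + 1)\<^sup>2 / 4\<rfloor>)"
  shows "\<exists>z b. slab P z b \<and> 1 / B \<le> D\<^sup>2 * (norm z)\<^sup>2 \<and> (dist v u < D \<longrightarrow> 1 / B < D\<^sup>2 * (norm z)\<^sup>2)"
proof -
  have len: "0 < dist v u" "dist v u \<le> D"
    using e D(2)[of v u] face_of_imp_subset[OF e(2)] by auto
  show ?thesis
  proof (cases "odd d")
    case True
    then obtain j where j: "d = 2 * j + 1" by (elim oddE)
    have dimj: "aff_dim P = 2 * int j + 1" using dim j by simp
    have B': "1 / B = real j + 1" unfolding B simplex_width_constant_odd[OF j] by simp
    obtain z b where z: "slab P z b" "1 / (dist v u)\<^sup>2 + real j / D\<^sup>2 \<le> (norm z)\<^sup>2"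
      using slab_from_edge[OF P e(2) e(1)[symmetric] dimj D] by blast
    have "D\<^sup>2 * (1 / (dist v u)\<^sup>2 + real j / D\<^sup>2) \<le> D\<^sup>2 * (norm z)\<^sup>2"
      using z(2) by (intro mult_left_mono) auto
    then have ge: "D\<^sup>2 / (dist v u)\<^sup>2 + real j \<le> D\<^sup>2 * (norm z)\<^sup>2" using D(1) by (simp add: distrib_left)
    have "1 \<le> D\<^sup>2 / (dist v u)\<^sup>2" using len by (simp add: le_divide_eq power_mono)
    moreover have "1 < D\<^sup>2 / (dist v u)\<^sup>2" if "dist v u < D"
      using len that by (simp add: less_divide_eq power_strict_mono)
    ultimately have "1 / B \<le> D\<^sup>2 * (norm z)\<^sup>2 \<and> (dist v u < D \<longrightarrow> 1 / B < D\<^sup>2 * (norm z)\<^sup>2)"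
      unfolding B' using ge by (intro conjI impI) (linarith, force)
    then show ?thesis using z(1) by blast
  next
    case False
    then obtain r where r: "d = 2 * r" by (auto elim: evenE)
    then have r1: "r \<ge> 1" using d by simp
    have B': "1 / B = real r + real r / (2 * real r + 1)"
      unfolding B simplex_width_constant_even[OF r] using r1 by (simp add: field_simps)
    have "aff_dim (closed_segment v u) = 1"
      using e(1) by (simp add: segment_convex_hull aff_dim_convex_hull aff_dim_2)
    then have "closed_segment v u \<noteq> P" using dim d by auto
    then obtain F where F: "F facet_of P" "closed_segment v u face_of F"
      using face_in_facet[OF P e(2)] by auto
    have "aff_dim P = 2 * int r" using dim r by simp
    define q where "q = (dist v u)\<^sup>2 / D\<^sup>2"
    from slab_even_dim[OF P \<open>aff_dim P = 2 * int r\<close> r1 F(1) D e(1) F(2)]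
    obtain z b where z: "slab P z b" "real r + real r / (2 * real r + 1) + (1 - q) / 2 \<le> D\<^sup>2 * (norm z)\<^sup>2"
      unfolding q_def by blast
    have q1: "q \<le> 1" using len D(1) by (simp add: q_def power_mono)
    have q2: "q < 1" if "dist v u < D" using that D(1) by (simp add: q_def power_strict_mono)
    have "1 / B \<le> D\<^sup>2 * (norm z)\<^sup>2" unfolding B' by (rule order_trans[OF _ z(2)]) (use q1 in simp)
    moreover have "1 / B < D\<^sup>2 * (norm z)\<^sup>2" if "dist v u < D"
      unfolding B' by (rule less_le_trans[OF _ z(2)]) (use q2[OF that] in simp)
    ultimately show ?thesis using z(1) by blast
  qed
qed

section \<open>The case of equality\<close>

lemma facial_distance_nonneg:
  fixes P :: "'a::euclidean_space set"
  assumes "polytope P" "1 \<le> aff_dim P"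
  shows "0 \<le> facial_distance P"
proof -
  have "facial_distance P \<in> (\<lambda>F. setdist F (convex hull (vertices P - F))) ` proper_faces P"
    unfolding facial_distance_def
    using finite_proper_faces[OF assms(1)] proper_faces_nonempty[OF assms] by (intro Min_in) auto
  then show ?thesis by (auto simp: setdist_pos_le)
qed

text \<open>Affinely dependent vertices would produce an edge of squared length at most
  \<open>2 * R < D\<^sup>2\<close>. For independent ones all pairs are edges, so \<open>D\<close>
  bounds their distances from both sides.\<close>

lemma equilateral_vertices_imp_regular_simplex:
  fixes P :: "'a::euclidean_space set"
  assumes P: "polytope P" "aff_dim P = int d" "d > 0"
    and D: "0 < D" "\<And>v w. v \<in> P \<Longrightarrow> w \<in> P \<Longrightarrow> dist v w \<le> D"
    and edges: "\<And>v u. u \<noteq> v \<Longrightarrow> closed_segment v u face_of P \<Longrightarrow> D \<le> dist v u"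
  shows "regular_simplex d P"
proof -
  have DV: "dist a b \<le> D" if "a \<in> vertices P" "b \<in> vertices P" for a b
    using D(2)[OF subsetD[OF vertices_subset that(1)] subsetD[OF vertices_subset that(2)]] .
  have hull: "convex hull (vertices P) = P" using convex_hull_vertices P by blast
  have indep: "\<not> affine_dependent (vertices P)"
  proof
    assume dep: "affine_dependent (vertices P)"
    have "P \<noteq> {}" using P by auto
    then obtain c R where c: "variance_center P c R" using variance_center_exists[OF P(1)] by blast
    obtain v u where e: "u \<noteq> v" "closed_segment v u face_of P" "(dist v u)\<^sup>2 \<le> 2 * R"
      by (rule nonsimplex_short_edge[OF P(1) dep c])
    have "D\<^sup>2 \<le> (dist v u)\<^sup>2" using edges[OF e(1,2)] D(1) by (intro power_mono) auto
    moreover have "2 * R < D\<^sup>2" by (rule variance_center_less[OF P(1) c D(1) DV])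
    ultimately show False using e(3) by simp
  qed
  have "aff_dim (vertices P) = int (card (vertices P)) - 1"
    using indep affine_independent_iff_card by blast
  moreover have "aff_dim (vertices P) = aff_dim P" using aff_dim_convex_hull[of "vertices P"] hull by simp
  ultimately have card: "card (vertices P) = d + 1" using P(2) by simp
  have "dist x y = D" if "x \<in> vertices P" "y \<in> vertices P" "x \<noteq> y" for x y
    using DV[OF that(1,2)] edges[of y x] simplex_edge[OF indep that(1,2)] that(3) hull by auto
  then show ?thesis unfolding regular_simplex_def using indep card hull by metis
qed

section \<open>Distances between complementary faces of a regular simplex\<close>

lemma sum_squares_ge_inverse_card:
  fixes a :: "'b \<Rightarrow> real"
  assumes "finite A" "sum a A = 1"
  shows "1 / real (card A) \<le> (\<Sum>x\<in>A. (a x)\<^sup>2)"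
proof -
  have "A \<noteq> {}" using assms(2) by auto
  then have "0 < card A" using assms(1) by (simp add: card_gt_0_iff)
  moreover have "(sum a A)\<^sup>2 \<le> (\<Sum>x\<in>A. (a x)\<^sup>2) * real (card A)"
    by (rule sum_squared_le_sum_of_squares)
  ultimately show ?thesis using assms(2) by (simp add: divide_le_eq)
qed

text \<open>This is Pythagoras when \<open>C\<close> is realised as \<open>r / sqrt 2\<close> times
  an orthonormal system, with \<open>a\<close> and \<open>b\<close> of disjoint support. The
  derivation avoids coordinates by using the parallel axis identity twice: from each
  \<open>v\<close> in \<open>U\<close> to \<open>x\<close>, then from \<open>x\<close> to
  \<open>y\<close>.\<close>

lemma regular_simplex_dist_sq:
  fixes C :: "'a::euclidean_space set"
  assumes fin: "finite C" and eq: "\<And>x y. x \<in> C \<Longrightarrow> y \<in> C \<Longrightarrow> x \<noteq> y \<Longrightarrow> dist x y = r"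
    and T: "T \<subseteq> C" and U: "U \<subseteq> C" and TU: "T \<inter> U = {}"
    and a: "sum a T = 1" "x = (\<Sum>v\<in>T. a v *\<^sub>R v)"
    and b: "sum b U = 1" "y = (\<Sum>v\<in>U. b v *\<^sub>R v)"
  shows "(dist x y)\<^sup>2 = r\<^sup>2 / 2 * ((\<Sum>v\<in>T. (a v)\<^sup>2) + (\<Sum>v\<in>U. (b v)\<^sup>2))"
proof -
  \<comment> \<open>The variance of weights \<open>c\<close> on equidistant points, found by
    averaging \<open>one\<close> over \<open>v\<close> with the weights \<open>c\<close>
    themselves.\<close>
  have half: "(\<Sum>v\<in>S. c v * (norm v)\<^sup>2) - (norm p)\<^sup>2 = r\<^sup>2 / 2 * (1 - (\<Sum>v\<in>S. (c v)\<^sup>2))"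
    if S: "S \<subseteq> C" and c: "sum c S = 1" "p = (\<Sum>v\<in>S. c v *\<^sub>R v)" for S c p
  proof -
    define W where "W = (\<Sum>v\<in>S. c v * (norm v)\<^sup>2) - (norm p)\<^sup>2"
    have finS: "finite S" using S fin finite_subset by blast
    have id: "(\<Sum>w\<in>S. c w * (dist w v)\<^sup>2) = (dist v p)\<^sup>2 + W" for v
      unfolding W_def by (rule variance_about_point[OF finS c])
    have one: "(\<Sum>w\<in>S. c w * (dist w v)\<^sup>2) = (1 - c v) * r\<^sup>2" if v: "v \<in> S" for v
    proof -
      have "(\<Sum>w\<in>S. c w * (dist w v)\<^sup>2) = (\<Sum>w\<in>S - {v}. c w * (dist w v)\<^sup>2)"
        using finS v by (simp add: sum.remove)
      also have "\<dots> = (\<Sum>w\<in>S - {v}. c w * r\<^sup>2)"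
        using eq S v by (intro sum.cong) auto
      also have "\<dots> = (1 - c v) * r\<^sup>2"
        using sum.remove[OF finS v, of c] c(1) by (simp add: sum_distrib_right[symmetric])
      finally show ?thesis .
    qed
    have "(\<Sum>v\<in>S. c v * ((1 - c v) * r\<^sup>2)) = (\<Sum>v\<in>S. c v * ((dist v p)\<^sup>2 + W))"
      using one id by (intro sum.cong) auto
    also have "\<dots> = (\<Sum>v\<in>S. c v * (dist v p)\<^sup>2) + sum c S * W"
      by (simp only: distrib_left sum.distrib sum_distrib_right)
    also have "\<dots> = 2 * W" using id[of p] c(1) by simp
    also have "(\<Sum>v\<in>S. c v * ((1 - c v) * r\<^sup>2)) = (\<Sum>v\<in>S. c v * r\<^sup>2 - (c v)\<^sup>2 * r\<^sup>2)"
      by (intro sum.cong refl) (simp add: power2_eq_square algebra_simps)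
    also have "\<dots> = r\<^sup>2 - (\<Sum>v\<in>S. (c v)\<^sup>2) * r\<^sup>2"
      using c(1) by (simp add: sum_subtractf sum_distrib_right[symmetric])
    finally show ?thesis unfolding W_def[symmetric] by (simp add: algebra_simps)
  qed
  have finT: "finite T" and finU: "finite U" using T U fin finite_subset by blast+
  have vx: "(dist v x)\<^sup>2 = r\<^sup>2 / 2 * (1 + (\<Sum>v\<in>T. (a v)\<^sup>2))" if v: "v \<in> U" for v
  proof -
    have "(\<Sum>w\<in>T. a w * (dist w v)\<^sup>2) = (\<Sum>w\<in>T. a w * r\<^sup>2)"
      using eq T U TU v by (intro sum.cong refl) (metis IntI empty_iff subsetD)
    then have "r\<^sup>2 = (dist v x)\<^sup>2 + r\<^sup>2 / 2 * (1 - (\<Sum>v\<in>T. (a v)\<^sup>2))"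
      using variance_about_point[OF finT a, of v] half[OF T a] a(1)
      by (simp add: sum_distrib_right[symmetric])
    then show ?thesis by (simp add: algebra_simps)
  qed
  have "(\<Sum>w\<in>U. b w * (dist w x)\<^sup>2) = (\<Sum>w\<in>U. b w * (r\<^sup>2 / 2 * (1 + (\<Sum>v\<in>T. (a v)\<^sup>2))))"
    by (intro sum.cong) (simp_all only: vx)
  also have "\<dots> = r\<^sup>2 / 2 * (1 + (\<Sum>v\<in>T. (a v)\<^sup>2))"
    by (simp only: sum_distrib_right[symmetric] b(1) mult_1)
  finally have "r\<^sup>2 / 2 * (1 + (\<Sum>v\<in>T. (a v)\<^sup>2)) = (dist x y)\<^sup>2 + r\<^sup>2 / 2 * (1 - (\<Sum>v\<in>U. (b v)\<^sup>2))"
    using variance_about_point[OF finU b, of x] half[OF U b] by simp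
  then show ?thesis by (simp add: algebra_simps)
qed

text \<open>The right-hand side is \<open>(d + 1) / (2 * k * m)\<close>. The integer
  \<open>k * m\<close> is at most \<open>(d + 1)\<^sup>2 / 4\<close>, hence at most its
  floor.\<close>

lemma split_constant_le:
  assumes k: "0 < k" and m: "0 < m" and n: "k + m = d + (1::nat)"
  shows "(real d + 1) / (2 * real_of_int \<lfloor>(real d + 1)\<^sup>2 / 4\<rfloor>) \<le> (1 / real k + 1 / real m) / 2"
proof -
  have n': "real k + real m = real d + 1" using n by linarith
  have "4 * (real k * real m) \<le> (real k + real m)\<^sup>2"
    using zero_le_power2[of "real k - real m"] by (simp add: power2_eq_square algebra_simps)
  then have "real_of_int (int k * int m) \<le> (real d + 1)\<^sup>2 / 4" using n' by simp
  then have "int k * int m \<le> \<lfloor>(real d + 1)\<^sup>2 / 4\<rfloor>" by (simp only: le_floor_iff)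
  then have le: "real k * real m \<le> real_of_int \<lfloor>(real d + 1)\<^sup>2 / 4\<rfloor>"
    by (metis of_int_le_iff of_int_mult of_int_of_nat_eq)
  have pos: "0 < real k * real m" using k m by simp
  have "(real d + 1) / (2 * real_of_int \<lfloor>(real d + 1)\<^sup>2 / 4\<rfloor>) \<le> (real d + 1) / (2 * (real k * real m))"
    by (rule frac_le) (use le pos in linarith)+
  also have "\<dots> = (1 / real k + 1 / real m) / 2" unfolding n'[symmetric] using k m by (simp add: field_simps)
  finally show ?thesis .
qed

text \<open>A proper face and the hull of the remaining vertices carry complementary vertex sets of
  sizes \<open>k\<close> and \<open>m\<close>. By Cauchy-Schwarz on the weights their squared
  distance is at least \<open>r\<^sup>2 * (1 / k + 1 / m) / 2\<close>, which is smallest for a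
  balanced split.\<close>

lemma regular_simplex_facial_distance:
  fixes P :: "'a::euclidean_space set"
  assumes P: "regular_simplex d P" and d: "d > 0"
    and B: "B = (real d + 1) / (2 * real_of_int \<lfloor>(real d + 1)\<^sup>2 / 4\<rfloor>)"
  shows "diameter P * sqrt B \<le> facial_distance P"
proof -
  obtain C r where indep: "\<not> affine_dependent C" and card: "card C = d + 1"
    and eqr: "\<forall>x\<in>C. \<forall>y\<in>C. x \<noteq> y \<longrightarrow> dist x y = r" and hull: "P = convex hull C"
    using P unfolding regular_simplex_def by (elim exE conjE)
  have eq: "dist x y = r" if "x \<in> C" "y \<in> C" "x \<noteq> y" for x y using eqr that by blast
  have fin: "finite C" using card d card.infinite by force
  have polP: "polytope P" unfolding hull using fin by (rule polytope_convex_hull)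
  have V: "vertices P = C"
    unfolding vertices_def hull using extreme_point_of_convex_hull_affine_independent[OF indep] by blast
  have Cne: "C \<noteq> {}" using card by auto
  have "\<not> card C \<le> 1" using card d by simp
  then obtain x0 y0 where xy: "x0 \<in> C" "y0 \<in> C" "x0 \<noteq> y0" using fin by (metis card_le_Suc0_iff_eq One_nat_def)
  have r0: "0 < r" using eq[OF xy] xy(3) zero_less_dist_iff by blast
  have "diameter P \<le> r"
  proof (rule diameter_le)
    show "P \<noteq> {} \<or> 0 \<le> r" using r0 by simp
    fix x y assume "x \<in> P" "y \<in> P"
    then obtain u v where "u \<in> C" "v \<in> C" "norm (x - y) \<le> norm (u - v)"
      using simplex_extremal_le[OF fin Cne] unfolding hull by blast
    then show "norm (x - y) \<le> r" using eq[of u v] r0 by (cases "u = v") (auto simp: dist_norm)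
  qed
  have "1 \<le> aff_dim P" using indep card d hull
    by (simp add: aff_dim_convex_hull affine_independent_iff_card)
  then have ne: "proper_faces P \<noteq> {}" using proper_faces_nonempty[OF polP] by blast
  have B0: "0 \<le> B" unfolding B by simp
  have "r * sqrt B \<le> facial_distance P"
    unfolding facial_distance_def
  proof (subst Min_ge_iff)
    show "\<forall>a\<in>(\<lambda>F. setdist F (convex hull (vertices P - F))) ` proper_faces P. r * sqrt B \<le> a"
    proof safe
      fix F assume F: "F \<in> proper_faces P"
      then have FP: "F face_of P" "F \<noteq> {}" by (auto simp: proper_faces_def)
      define T where "T = C \<inter> F"
      have polF: "polytope F" using FP polP face_of_polytope_polytope by blast
      have FT: "F = convex hull T"
        using convex_hull_vertices[OF polF] vertices_face[OF FP(1)] V by (simp add: T_def)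
      define U where "U = C - F"
      have Une: "U \<noteq> {}" using vertices_not_in_proper_face[OF polP F] V by (simp add: U_def)
      have Tne: "T \<noteq> {}" using FP(2) FT by auto
      have finTU: "finite T" "finite U" using fin by (auto simp: T_def U_def)
      have sub: "T \<subseteq> C" "U \<subseteq> C" by (auto simp: T_def U_def)
      have "T \<union> U = C" "T \<inter> U = {}" by (auto simp: T_def U_def)
      then have cards: "card T + card U = d + 1" using card card_Un_disjoint[OF finTU] by simp
      have pos: "0 < card T" "0 < card U" using Tne Une finTU by (auto simp: card_gt_0_iff)
      show "r * sqrt B \<le> setdist F (convex hull (vertices P - F))"
      proof (rule le_setdistI)
        show "F \<noteq> {}" "convex hull (vertices P - F) \<noteq> {}" using FP Une V by (auto simp: U_def)
        fix x y assume "x \<in> F" "y \<in> convex hull (vertices P - F)"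
        then have "x \<in> convex hull T" "y \<in> convex hull U" using FT V by (auto simp: U_def)
        then obtain a b where a: "sum a T = 1" "x = (\<Sum>v\<in>T. a v *\<^sub>R v)"
          and b: "sum b U = 1" "y = (\<Sum>v\<in>U. b v *\<^sub>R v)"
          unfolding convex_hull_finite[OF finTU(1)] convex_hull_finite[OF finTU(2)] by blast
        have "(r * sqrt B)\<^sup>2 = r\<^sup>2 * B" using B0 by (simp add: power_mult_distrib)
        also have "\<dots> \<le> r\<^sup>2 * ((1 / real (card T) + 1 / real (card U)) / 2)"
          using split_constant_le[OF pos cards] by (intro mult_left_mono) (auto simp: B)
        also have "\<dots> \<le> r\<^sup>2 * (((\<Sum>v\<in>T. (a v)\<^sup>2) + (\<Sum>v\<in>U. (b v)\<^sup>2)) / 2)"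
          using sum_squares_ge_inverse_card[OF finTU(1) a(1)] sum_squares_ge_inverse_card[OF finTU(2) b(1)]
          by (intro mult_left_mono divide_right_mono add_mono) auto
        also have "\<dots> = (dist x y)\<^sup>2"
          using regular_simplex_dist_sq[OF fin eq sub \<open>T \<inter> U = {}\<close> a b] by simp
        finally show "r * sqrt B \<le> dist x y" by (rule power2_le_imp_le) simp
      qed
    qed
  qed (use finite_proper_faces[OF polP] ne in auto)
  moreover have "diameter P * sqrt B \<le> r * sqrt B"
    using \<open>diameter P \<le> r\<close> B0 by (intro mult_right_mono) auto
  ultimately show ?thesis by linarith
qed

theorem theorem1p1:
  fixes P :: "'a::euclidean_space set" and d :: nat
  assumes "d \<ge> 2"
    and "polytope P"
    and "aff_dim P = int d"
  shows "facial_distance P / diameter P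
           \<le> sqrt ((real d + 1) / (2 * real_of_int \<lfloor>(real d + 1)\<^sup>2 / 4\<rfloor>))
       \<and> (facial_distance P / diameter P
           = sqrt ((real d + 1) / (2 * real_of_int \<lfloor>(real d + 1)\<^sup>2 / 4\<rfloor>))
          \<longleftrightarrow> regular_simplex d P)"
proof -
  define B where "B = (real d + 1) / (2 * real_of_int \<lfloor>(real d + 1)\<^sup>2 / 4\<rfloor>)"
  define D where "D = diameter P"
  define q where "q = facial_distance P / D"
  have dist: "dist v w \<le> D" if "v \<in> P" "w \<in> P" for v w
    using diameter_bounded_bound[OF polytope_imp_bounded[OF assms(2)]] that by (simp add: D_def)
  have dim: "0 < aff_dim P" "1 \<le> aff_dim P" using assms by auto
  obtain v0 u0 where e0: "u0 \<noteq> v0" "closed_segment v0 u0 face_of P"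
    by (rule shortest_edge_exists[OF assms(2) dim(1)])
  have "v0 \<in> P" "u0 \<in> P" using face_of_imp_subset[OF e0(2)] by auto
  \<comment> \<open>An edge supplies two distinct points, so the division by the diameter is
    genuine.\<close>
  then have D0: "0 < D" using dist[of v0 u0] e0(1) by (auto intro: less_le_trans[of 0 "dist v0 u0"])
  have q0: "0 \<le> q" using facial_distance_nonneg[OF assms(2) dim(2)] D0 by (simp add: q_def)
  have "1 \<le> (real d + 1)\<^sup>2 / 4"
  proof -
    have "2\<^sup>2 \<le> (real d + 1)\<^sup>2" using assms(1) by (intro power_mono) auto
    then show ?thesis by simp
  qed
  then have "1 \<le> \<lfloor>(real d + 1)\<^sup>2 / 4\<rfloor>" by (simp add: le_floor_iff)
  then have B0: "0 < B" by (simp add: B_def)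
  have bound: "q\<^sup>2 \<le> B \<and> (dist v u < D \<longrightarrow> q\<^sup>2 < B)" if e: "u \<noteq> v" "closed_segment v u face_of P" for v u
  proof -
    obtain z b where z: "slab P z b" and zB: "1 / B \<le> D\<^sup>2 * (norm z)\<^sup>2"
      and zB': "dist v u < D \<longrightarrow> 1 / B < D\<^sup>2 * (norm z)\<^sup>2"
      using slab_bound[OF assms(2,3,1) D0 dist e B_def] by blast
    \<comment> \<open>\<open>slab_facial_distance\<close> becomes
      \<open>q\<^sup>2 * n \<le> 1\<close> after scaling, and \<open>slab_bound\<close> compares
      \<open>n\<close> with \<open>1 / B\<close>.\<close>
    define n where "n = D\<^sup>2 * (norm z)\<^sup>2"
    have n0: "0 < n" using zB B0 unfolding n_def by (smt (verit) divide_pos_pos)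
    have "q * (D * norm z) \<le> 1"
      using slab_facial_distance[OF assms(2) z] D0 by (simp add: q_def)
    moreover have "0 \<le> q * (D * norm z)" using q0 D0 by simp
    ultimately have "(q * (D * norm z))\<^sup>2 \<le> 1" by (simp add: power_le_one)
    then have "q\<^sup>2 * n \<le> 1" by (simp add: n_def power_mult_distrib)
    then have "q\<^sup>2 \<le> 1 / n" using n0 by (simp add: le_divide_eq)
    moreover have "1 / n \<le> B" using zB B0 n0 by (simp add: n_def[symmetric] divide_le_eq mult.commute)
    moreover have "1 / n < B" if "dist v u < D"
      using zB' that B0 n0 by (simp add: n_def[symmetric] divide_less_eq mult.commute)
    ultimately show ?thesis by fastforce
  qed
  have le: "q \<le> sqrt B" using bound[OF e0] by (intro real_le_rsqrt) blast
  moreover have "regular_simplex d P" if q: "q = sqrt B"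
  proof (rule equilateral_vertices_imp_regular_simplex[OF assms(2,3) _ D0 dist])
    show "0 < d" using assms(1) by simp
    fix v u assume e: "u \<noteq> v" "closed_segment v u face_of P"
    have "q\<^sup>2 = B" using q B0 by simp
    \<comment> \<open>Equality excludes the strict bound, so no edge is shorter than
      \<open>D\<close>.\<close>
    then show "D \<le> dist v u" using bound[OF e] by force
  qed
  moreover have "q = sqrt B" if "regular_simplex d P"
  proof (rule antisym[OF le])
    have "D * sqrt B \<le> facial_distance P"
      using regular_simplex_facial_distance[OF that _ B_def] assms(1) by (simp add: D_def)
    then show "sqrt B \<le> q" using D0 by (simp add: q_def le_divide_eq mult.commute)
  qed
  ultimately show ?thesis unfolding q_def D_def B_def by blast
qed

end
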